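(* Assume that $\log p/n=o(1)$ as $n\to\infty$ and that there is a constant $\sigma>3\eta>0$ with $\phi_{\max}\ge\phi_j+\sigma$ for all $j\ge2$. Assume further that $\{\bm X_t\}_{t\in\mathbb Z}$ satisfies: (i) there are constants $c,\gamma_1>0$ with $\beta(n)\le2\exp(-cn^{\gamma_1})$ for all $n\in\mathbb N$; (ii) there are constants $\gamma_2>0$, $K>0$ such that $\{\bm X_t\}$ is sub-Weibull $(\gamma_2)$ with $\|\bm X_t\|_{\psi_{\gamma_2}}\le K$ for all $t\in\mathbb Z$; (iii) $\gamma:=\bigl(\frac1{\gamma_1}+\frac2{\gamma_2}\bigr)^{-1}<1$; (iv) $\log p/n^{\gamma}=o(1)$ as $n\to\infty$. Let $C>1$ be a universal constant, $\tilde b>0$, and let $C_1,C_2>0$ be the constants (depending only on $c,\gamma_1,\gamma_2$) and $\tau_{1n},\tau_{2n}$ the sequences described in the context. Assume $n>4$, $\zeta_n>\tau_{2n}$, $\tau_{1n}<\xi_n<\sigma-3\eta$, and $\lambda_1>\frac{C+1}{C-1}\zeta_n\|\bm\beta^0\|_1$. Assume moreover that \[ \xi_n\asymp\frac{(\log n)^{1/\gamma}}{n^{1-\alpha}}\ \text{ for some }\alpha\in(0,1/2),\qquad \lambda_1\asymp\sqrt{s_0}\,\phi_{\max}\sqrt{\frac{\log p}{n}}. \] Then, as $n\to\infty$, \[ \|\hat{\bm\beta}_n^1-\bm\beta^0\|_1=O_p\left(s_0^{3/2}\phi_{\max}\sqrt{\frac{\log p}{n}}\right) \quad\text{and}\quad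 \|\hat{\bm\beta}_n^1-\bm\beta^0\|_2^2=O_p\left(s_0^3\phi_{\max}^2\frac{\log p}{n}\right). \]
   Context: $\{\bm X_t\}_{t\in\mathbb Z}$ is an $\mathbb R^p$-valued, strictly stationary, centered time series, with $p=p(n)$ allowed to depend on the sample size $n$; $\bm X_1,\dots,\bm X_n$ are observed. Put $\Sigma_0=E[\bm X_t\bm X_t^\top]$ and $\hat\Sigma_n=\frac1n\sum_{t=1}^n\bm X_t\bm X_t^\top$. The eigenvalues of $\Sigma_0$ are written $\phi_1^2\ge\dots\ge\phi_p^2$ with $\phi_1\ge\dots\ge\phi_p\ge0$, and $\phi_{\max}:=\phi_1$ (so $\phi_{\max}^2$ is the largest eigenvalue of $\Sigma_0$). Let $\bm q^0$ be a unit ($l_2$) eigenvector of $\Sigma_0$ for $\phi_{\max}^2$ and $\bm\beta^0:=\phi_{\max}\bm q^0$. Let $S=\{j:\bm\beta^0_j\ne0\}$ and $s_0=|S|$. For a constant $\eta>0$ let $\mathcal B=\{\bm\beta\in\mathbb R^p:\|\bm\beta-\bm\beta^0\|_2\le\eta\}$. For a tuning parameter $\lambda_1\ge0$ (depending on $n$), the Lasso-type estimator is \[ \hat{\bm\beta}_n^1:=\arg\min_{\bm\beta\in\mathcal B}\Bigl\{\tfrac14\|\hat\Sigma_n-\bm\beta\bm\beta^\top\|_F^2+\lambda_1\|\bm\beta\|_1\Bigr\}, \] where $\|\cdot\|_F$ is the Frobenius norm. The $\beta$-mixing coefficients are $\beta(l):=\sup\frac12\sum_{i=1}^I\sum_{j=1}^J|P(A_i\cap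 B_j)-P(A_i)P(B_j)|$, the supremum being over all pairs of finite partitions $\{A_i\}\subset\sigma(\bm X_s,s\le t)$, $\{B_j\}\subset\sigma(\bm X_s,s\ge t+l)$. A real random variable $X$ is sub-Weibull $(\gamma)$, $\gamma>0$, if there is $K>0$ with $(E|X|^q)^{1/q}\le Kq^{1/\gamma}$ for all $q\ge 1\wedge\gamma$; its norm is $\|X\|_{\psi_\gamma}:=\sup_{q\ge1}(E|X|^q)^{1/q}q^{-1/\gamma}$. An $\mathbb R^p$-valued $\bm X$ is sub-Weibull $(\gamma)$ if each component is, with norm $\|\bm X\|_{\psi_\gamma}:=\sup_{\|\bm v\|_2=1}\|\bm v^\top\bm X\|_{\psi_\gamma}$. Put $K_2:=2^{2/\gamma_2}K^2$, and \[ \tau_{1n}:=\frac{K_2C_1^{1/\gamma}(\log n)^{1/\gamma}}{n},\qquad \tau_{2n}:=\max\left\{\frac{K_2C_1^{1/\gamma}(\log (np^2)+2\tilde b\log p)^{1/\gamma}}{n},\ K_2\sqrt{\frac{2C_2(\tilde b+1)\log p}{n}}\right\}. \] The constants $C_1,C_2>0$, depending only on $c,\gamma_1,\gamma_2$, are such that the following oracle inequality holds: for every $\tilde b>0$, $n>4$, $\zeta_n>\tau_{2n}$, $\tau_{1n}<\xi_n<\sigma-3\eta$ and $\lambda_1>\frac{C+1}{C-1}\zeta_n\|\bm\beta^0\|_1$, with probability at least $1-2\exp(-\tilde b\log(p^2))-2n\exp(-(\xi_nn)^\gamma/(K_2^\gamma C_1))-2\exp(-\xi_n^2n/(K_2^2C_2))$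 one has $\|\hat{\bm\beta}_n^1-\bm\beta^0\|_1\le2(C+1)^2s_0\lambda_1/(\sigma-3\eta-\xi_n)$. $a_n\asymp b_n$ means that $a_n/b_n$ is bounded above and below by positive constants. "Universal constant" means a constant not depending on $n$, $p$ or the law of the process. *)

theory Defs
  imports
    "HOL-Probability.Probability"
    "HOL-Library.Landau_Symbols"
    "Jordan_Normal_Form.Char_Poly"
begin

no_notation Finite_Cartesian_Product.vec_nth (infixl \<open>$\<close> 90)
no_notation Inner_Product.real_inner_class.inner (infix \<open>\<bullet>\<close> 70)

section \<open>Vectors and matrices\<close>

definition l1_norm :: "real vec \<Rightarrow> real" where
  "l1_norm v = (\<Sum>j<dim_vec v. \<bar>v $ j\<bar>)"

definition l2_norm :: "real vec \<Rightarrow> real" where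
  "l2_norm v = sqrt (\<Sum>j<dim_vec v. (v $ j)\<^sup>2)"

definition frobenius_norm :: "real mat \<Rightarrow> real" where
  "frobenius_norm A = sqrt (\<Sum>i<dim_row A. \<Sum>j<dim_col A. (A $$ (i, j))\<^sup>2)"

definition outer :: "real vec \<Rightarrow> real mat" where
  "outer v = mat (dim_vec v) (dim_vec v) (\<lambda>(i, j). v $ i * v $ j)"

definition sparsity :: "real vec \<Rightarrow> nat" where
  "sparsity v = card {j. j < dim_vec v \<and> v $ j \<noteq> 0}"

text \<open>The eigenvalues of the matrix, with multiplicity and in decreasing order, are
  the squares of \<open>\<phi> 1 \<ge> \<dots> \<ge> \<phi> p \<ge> 0\<close>. Only the values of \<open>\<phi>\<close> on \<open>{1..p}\<close> matter.\<close>

definition ordered_root_eigenvalues :: "real mat \<Rightarrow> (nat \<Rightarrow> real) \<Rightarrow> bool" where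
  "ordered_root_eigenvalues A \<phi> \<longleftrightarrow>
     char_poly A = (\<Prod>j\<in>{1..dim_row A}. [:- (\<phi> j)\<^sup>2, 1:]) \<and>
     (\<forall>j\<in>{1..dim_row A}. 0 \<le> \<phi> j) \<and>
     (\<forall>i\<in>{1..dim_row A}. \<forall>j\<in>{1..dim_row A}. i \<le> j \<longrightarrow> \<phi> j \<le> \<phi> i)"

section \<open>Time series with values in \<open>\<real>\<^sup>p\<close>\<close>

text \<open>Since \<open>p\<close> varies with the sample size, \<open>\<real>\<^sup>p\<close> is \<^term>\<open>carrier_vec p\<close>; its Borel sets
  are those generated by the coordinates.\<close>

definition vec_borel :: "nat \<Rightarrow> real vec measure" where
  "vec_borel p = vimage_algebra (carrier_vec p)
     (\<lambda>v. \<lambda>j\<in>{..<p}. v $ j) (\<Pi>\<^sub>M j\<in>{..<p}. borel)"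

definition time_series :: "'a measure \<Rightarrow> nat \<Rightarrow> (int \<Rightarrow> 'a \<Rightarrow> real vec) \<Rightarrow> bool" where
  "time_series M p X \<longleftrightarrow> prob_space M \<and> (\<forall>t. X t \<in> measurable M (vec_borel p))"

definition strictly_stationary ::
    "'a measure \<Rightarrow> nat \<Rightarrow> (int \<Rightarrow> 'a \<Rightarrow> real vec) \<Rightarrow> bool" where
  "strictly_stationary M p X \<longleftrightarrow>
     (\<forall>T h. finite T \<longrightarrow>
        distr M (\<Pi>\<^sub>M t\<in>T. vec_borel p) (\<lambda>\<omega>. \<lambda>t\<in>T. X (t + h) \<omega>) =
        distr M (\<Pi>\<^sub>M t\<in>T. vec_borel p) (\<lambda>\<omega>. \<lambda>t\<in>T. X t \<omega>))"

definition centered :: "'a measure \<Rightarrow> nat \<Rightarrow> (int \<Rightarrow> 'a \<Rightarrow> real vec) \<Rightarrow> bool" where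
  "centered M p X \<longleftrightarrow>
     (\<forall>t. \<forall>j<p. integrable M (\<lambda>\<omega>. X t \<omega> $ j) \<and> (\<integral>\<omega>. X t \<omega> $ j \<partial>M) = 0)"

text \<open>By stationarity the time index used here is immaterial.\<close>

definition pop_cov :: "'a measure \<Rightarrow> nat \<Rightarrow> (int \<Rightarrow> 'a \<Rightarrow> real vec) \<Rightarrow> real mat" where
  "pop_cov M p X = mat p p (\<lambda>(i, j). \<integral>\<omega>. X 0 \<omega> $ i * X 0 \<omega> $ j \<partial>M)"

definition sample_cov :: "nat \<Rightarrow> nat \<Rightarrow> (int \<Rightarrow> 'a \<Rightarrow> real vec) \<Rightarrow> 'a \<Rightarrow> real mat" where
  "sample_cov n p X \<omega> =
     mat p p (\<lambda>(i, j). (1 / real n) * (\<Sum>t=1..n. X (int t) \<omega> $ i * X (int t) \<omega> $ j))"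

section \<open>The Lasso-type estimator\<close>

definition lasso_objective :: "real mat \<Rightarrow> real \<Rightarrow> real vec \<Rightarrow> real" where
  "lasso_objective S lam \<beta> = 1 / 4 * (frobenius_norm (S - outer \<beta>))\<^sup>2 + lam * l1_norm \<beta>"

text \<open>The minimiser need not be unique: an estimator is any random vector that is a
  minimiser over the ball around \<open>\<beta>0\<close> at every outcome.\<close>

definition lasso_estimator ::
    "'a measure \<Rightarrow> nat \<Rightarrow> nat \<Rightarrow> (int \<Rightarrow> 'a \<Rightarrow> real vec) \<Rightarrow> real vec \<Rightarrow> real \<Rightarrow> real \<Rightarrow>
      ('a \<Rightarrow> real vec) \<Rightarrow> bool" where
  "lasso_estimator M n p X \<beta>0 \<eta> lam bhat \<longleftrightarrow>
     bhat \<in> measurable M (vec_borel p) \<and>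
     (\<forall>\<omega>\<in>space M.
        is_arg_min (lasso_objective (sample_cov n p X \<omega>) lam)
          (\<lambda>\<beta>. \<beta> \<in> carrier_vec p \<and> l2_norm (\<beta> - \<beta>0) \<le> \<eta>) (bhat \<omega>))"

section \<open>Mixing and tails\<close>

definition generated_events ::
    "'a measure \<Rightarrow> nat \<Rightarrow> (int \<Rightarrow> 'a \<Rightarrow> real vec) \<Rightarrow> int set \<Rightarrow> 'a set set" where
  "generated_events M p X T =
     sigma_sets (space M) (\<Union>t\<in>T. {X t -` B \<inter> space M |B. B \<in> sets (vec_borel p)})"

definition beta_mixing_coeff ::
    "'a measure \<Rightarrow> nat \<Rightarrow> (int \<Rightarrow> 'a \<Rightarrow> real vec) \<Rightarrow> nat \<Rightarrow> real" where
  "beta_mixing_coeff M p X l = Sup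
     {1 / 2 * (\<Sum>A\<in>\<A>. \<Sum>B\<in>\<B>. \<bar>measure M (A \<inter> B) - measure M A * measure M B\<bar>) |\<A> \<B> t.
        finite \<A> \<and> partition_on (space M) \<A> \<and> \<A> \<subseteq> generated_events M p X {..t} \<and>
        finite \<B> \<and> partition_on (space M) \<B> \<and> \<B> \<subseteq> generated_events M p X {t + int l..}}"

text \<open>Integrability is required explicitly because the Bochner integral of a
  non-integrable function is \<open>0\<close>.\<close>

definition sub_weibull :: "'a measure \<Rightarrow> real \<Rightarrow> ('a \<Rightarrow> real) \<Rightarrow> bool" where
  "sub_weibull M \<gamma> Y \<longleftrightarrow> Y \<in> borel_measurable M \<and>
     (\<exists>K>0. \<forall>q\<ge>min 1 \<gamma>. integrable M (\<lambda>\<omega>. \<bar>Y \<omega>\<bar> powr q) \<and>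
        (\<integral>\<omega>. \<bar>Y \<omega>\<bar> powr q \<partial>M) powr (1 / q) \<le> K * q powr (1 / \<gamma>))"

definition psi_norm :: "'a measure \<Rightarrow> real \<Rightarrow> ('a \<Rightarrow> real) \<Rightarrow> ereal" where
  "psi_norm M \<gamma> Y =
     (SUP q\<in>{1..}. ereal ((\<integral>\<omega>. \<bar>Y \<omega>\<bar> powr q \<partial>M) powr (1 / q) * q powr (- 1 / \<gamma>)))"

definition sub_weibull_vec :: "'a measure \<Rightarrow> nat \<Rightarrow> real \<Rightarrow> ('a \<Rightarrow> real vec) \<Rightarrow> bool" where
  "sub_weibull_vec M p \<gamma> Y \<longleftrightarrow> (\<forall>j<p. sub_weibull M \<gamma> (\<lambda>\<omega>. Y \<omega> $ j))"

definition psi_norm_vec :: "'a measure \<Rightarrow> nat \<Rightarrow> real \<Rightarrow> ('a \<Rightarrow> real vec) \<Rightarrow> ereal" where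
  "psi_norm_vec M p \<gamma> Y =
     (SUP v\<in>{v \<in> carrier_vec p. l2_norm v = 1}. psi_norm M \<gamma> (\<lambda>\<omega>. v \<bullet> Y \<omega>))"

section \<open>The oracle inequality\<close>

definition K2_const :: "real \<Rightarrow> real \<Rightarrow> real" where
  "K2_const \<gamma>2 K = 2 powr (2 / \<gamma>2) * K\<^sup>2"

definition tau1 :: "real \<Rightarrow> real \<Rightarrow> real \<Rightarrow> nat \<Rightarrow> real" where
  "tau1 K2 C1 \<gamma> n = K2 * C1 powr (1 / \<gamma>) * ln (real n) powr (1 / \<gamma>) / real n"

definition tau2 ::
    "real \<Rightarrow> real \<Rightarrow> real \<Rightarrow> real \<Rightarrow> real \<Rightarrow> nat \<Rightarrow> nat \<Rightarrow> real" where
  "tau2 K2 C1 C2 \<gamma> b n p = max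
     (K2 * C1 powr (1 / \<gamma>) *
        (ln (real n * (real p)\<^sup>2) + 2 * b * ln (real p)) powr (1 / \<gamma>) / real n)
     (K2 * sqrt (2 * C2 * (b + 1) * ln (real p) / real n))"

text \<open>The oracle inequality with constants \<open>C1\<close>, \<open>C2\<close> for one process and one sample
  size. The arguments \<open>b\<close>, \<open>\<zeta>\<close>, \<open>\<xi>\<close>, \<open>lam\<close> and the estimator are all quantified inside.\<close>

definition oracle_inequality ::
    "'a measure \<Rightarrow> nat \<Rightarrow> nat \<Rightarrow> (int \<Rightarrow> 'a \<Rightarrow> real vec) \<Rightarrow> real vec \<Rightarrow> real \<Rightarrow> real \<Rightarrow>
      real \<Rightarrow> real \<Rightarrow> real \<Rightarrow> real \<Rightarrow> real \<Rightarrow> bool" where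
  "oracle_inequality M n p X \<beta>0 \<sigma> \<eta> K2 \<gamma> C C1 C2 \<longleftrightarrow>
     (\<forall>b \<zeta> \<xi> lam bhat.
        b > 0 \<longrightarrow> \<zeta> > tau2 K2 C1 C2 \<gamma> b n p \<longrightarrow>
        tau1 K2 C1 \<gamma> n < \<xi> \<longrightarrow> \<xi> < \<sigma> - 3 * \<eta> \<longrightarrow>
        lam > (C + 1) / (C - 1) * \<zeta> * l1_norm \<beta>0 \<longrightarrow>
        lasso_estimator M n p X \<beta>0 \<eta> lam bhat \<longrightarrow>
        measure M {\<omega> \<in> space M. l1_norm (bhat \<omega> - \<beta>0)
            \<le> 2 * (C + 1)\<^sup>2 * real (sparsity \<beta>0) * lam / (\<sigma> - 3 * \<eta> - \<xi>)}
          \<ge> 1 - 2 * exp (- b * ln ((real p)\<^sup>2))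
              - 2 * real n * exp (- ((\<xi> * real n) powr \<gamma> / (K2 powr \<gamma> * C1)))
              - 2 * exp (- (\<xi>\<^sup>2 * real n / (K2\<^sup>2 * C2))))"

section \<open>Stochastic boundedness\<close>

text \<open>\<open>Z n = O\<^sub>p(r n)\<close>, where the \<open>n\<close>-th random variable lives on its own
  probability space \<open>M n\<close>.\<close>

definition bounded_in_prob ::
    "(nat \<Rightarrow> 'a measure) \<Rightarrow> (nat \<Rightarrow> 'a \<Rightarrow> real) \<Rightarrow> (nat \<Rightarrow> real) \<Rightarrow> bool" where
  "bounded_in_prob M Z r \<longleftrightarrow>
     (\<forall>\<epsilon>>0. \<exists>B>0. \<forall>\<^sub>F n in sequentially.
        measure (M n) {\<omega> \<in> space (M n). \<bar>Z n \<omega>\<bar> > B * r n} < \<epsilon>)"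

end

theory Submission
  imports Defs "Jordan_Normal_Form.Schur_Decomposition" "HOL-Real_Asymp.Real_Asymp"
begin

text \<open>The oracle inequality is used with the constant \<open>\<xi>' = (\<sigma> - 3 \<eta>) / 2\<close> instead of \<open>\<xi> n\<close>:
  at the prescribed rate \<open>(\<xi> n)\<^sup>2 n\<close> tends to \<open>0\<close> because \<open>\<alpha> < 1/2\<close>, so that the last term
  of its probability bound would not vanish. With \<open>\<xi>'\<close> the only term that need not vanish is
  \<open>2 p\<^sup>-\<^sup>2\<^sup>b\<close>, which is below a given \<open>\<epsilon>\<close> only if \<open>p n\<close> exceeds some threshold \<open>P\<close>.

  For the sample sizes with \<open>p n \<le> P\<close> the bound is proved without the oracle inequality. The
  population risk grows at least like \<open>2 \<eta>\<^sup>2 \<parallel>\<beta> - \<beta>0\<parallel>\<^sup>2\<close> on the ball around \<open>\<beta>0\<close>, so the error of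
  any minimiser is at most a multiple of the Frobenius norm of the sampling error of the
  covariance matrix plus \<open>\<lambda>1 \<surd>p\<close>. That sampling error is \<open>O\<^sub>p(1 / \<surd>n)\<close> by Chebyshev's inequality,
  as \<open>\<beta>\<close>-mixing and moments of order \<open>8\<close> make the covariances of \<open>X\<^sub>t\<^sub>i X\<^sub>t\<^sub>j\<close> summable. The case
  \<open>p n = 1\<close> does not occur for large \<open>n\<close>: there \<open>ln (p n) = 0\<close> would force \<open>\<lambda>1 n \<le> 0\<close>.\<close>

section \<open>Quadratic forms and the spectral gap\<close>

text \<open>Exchanging the level \<xi> is legitimate because the oracle inequality covers every
  admissible level, while neither the estimator nor \<open>lam1\<close> involves it;
  \<open>tau1\<close> tends to 0, so a fixed level is eventually admissible. The threshold P depends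
  on \<epsilon> and b only, which O_p permits. Since \<open>p n\<close> may cross P infinitely
  often, one constant has to serve both regimes. When the dimension is at most P, powers of p are
  constants and it remains to compare 1 / sqrt n with the rate: ln p >= ln 2 once p >= 2, s0 >= 1,
  and the factor \<phi>_max occurs on both sides. The spectral gap is stated for roots of the
  characteristic polynomial, whereas the growth of the risk calls for a bound on the quadratic form
  of the covariance matrix on the complement of q. Eigenvectors of a simple root provide the passage
  from one to the other. Moments of order 8 enter because the covariance inequality uses fourth
  moments and its arguments are products of two coordinates.\<close>

definition bilinear_form :: "nat \<Rightarrow> (nat \<Rightarrow> nat \<Rightarrow> real) \<Rightarrow> (nat \<Rightarrow> real) \<Rightarrow> (nat \<Rightarrow> real) \<Rightarrow> real" where
  "bilinear_form p S x y = (\<Sum>i<p. \<Sum>j<p. S i j * x i * y j)"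

definition dot :: "nat \<Rightarrow> (nat \<Rightarrow> real) \<Rightarrow> (nat \<Rightarrow> real) \<Rightarrow> real" where
  "dot p x y = (\<Sum>i<p. x i * y i)"

lemma bilinear_form_add:
  "bilinear_form p S (\<lambda>i. x i + y i) z = bilinear_form p S x z + bilinear_form p S y z"
  "bilinear_form p S z (\<lambda>i. x i + y i) = bilinear_form p S z x + bilinear_form p S z y"
  by (simp_all add: bilinear_form_def sum.distrib algebra_simps)

lemma bilinear_form_scale:
  "bilinear_form p S (\<lambda>i. c * x i) z = c * bilinear_form p S x z"
  "bilinear_form p S z (\<lambda>i. c * x i) = c * bilinear_form p S z x"
  by (simp_all add: bilinear_form_def sum_distrib_left mult_ac)

lemma bilinear_form_commute:
  assumes "\<And>i j. i < p \<Longrightarrow> j < p \<Longrightarrow> S i j = S j i"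
  shows "bilinear_form p S x y = bilinear_form p S y x"
proof -
  have "bilinear_form p S x y = (\<Sum>j<p. \<Sum>i<p. S i j * x i * y j)"
    unfolding bilinear_form_def by (rule sum.swap)
  also have "\<dots> = bilinear_form p S y x"
    unfolding bilinear_form_def by (intro sum.cong refl) (use assms in \<open>auto simp: mult_ac\<close>)
  finally show ?thesis .
qed

lemma bilinear_form_eq_dot: "bilinear_form p S x y = dot p x (\<lambda>i. \<Sum>j<p. S i j * y j)"
  by (simp add: bilinear_form_def dot_def sum_distrib_left mult_ac)

lemma dot_add:
  "dot p (\<lambda>i. x i + y i) z = dot p x z + dot p y z"
  "dot p z (\<lambda>i. x i + y i) = dot p z x + dot p z y"
  by (simp_all add: dot_def sum.distrib algebra_simps)

lemma dot_scale:
  "dot p (\<lambda>i. c * x i) z = c * dot p x z"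
  "dot p z (\<lambda>i. c * x i) = c * dot p z x"
  by (simp_all add: dot_def sum_distrib_left mult_ac)

lemma dot_commute: "dot p x y = dot p y x"
  by (simp add: dot_def mult_ac)

lemma dot_self_nonneg: "0 \<le> dot p x x"
  by (simp add: dot_def sum_nonneg)

lemma dot_self_eq_0: "dot p x x = 0 \<longleftrightarrow> (\<forall>i<p. x i = 0)"
  by (auto simp: dot_def sum_nonneg_eq_0_iff)

lemma bilinear_form_eigenvector:
  assumes "\<And>i. i < p \<Longrightarrow> (\<Sum>j<p. S i j * x j) = \<mu> * x i"
  shows "bilinear_form p S y x = \<mu> * dot p y x"
proof -
  have "bilinear_form p S y x = dot p y (\<lambda>i. \<mu> * x i)"
    unfolding bilinear_form_eq_dot dot_def by (simp add: assms)
  then show ?thesis by (simp add: dot_scale)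
qed

text \<open>First-order condition at t = 0 for a polynomial bounded above by its value there. The
  witness t = a / (|b| + 1) is short enough for the linear term to dominate whatever the sign of
  b.\<close>

lemma linear_coeff_zero:
  fixes a b :: real
  assumes "\<And>t. 2 * t * a + t\<^sup>2 * b \<le> 0"
  shows "a = 0"
proof (rule ccontr)
  assume "a \<noteq> 0"
  define t where "t = a / (\<bar>b\<bar> + 1)"
  have *: "a = t * (\<bar>b\<bar> + 1)" by (simp add: t_def)
  have "t \<noteq> 0" using \<open>a \<noteq> 0\<close> * by auto
  have "2 * t * a + t\<^sup>2 * b = t\<^sup>2 * (2 * \<bar>b\<bar> + 2 + b)"
    by (subst *) (simp add: power2_eq_square algebra_simps)
  moreover have "\<dots> > 0" using \<open>t \<noteq> 0\<close> by (intro mult_pos_pos) auto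
  ultimately show False using assms[of t] by linarith
qed

text \<open>Vectors are functions on all naturals, so coordinates from p on are pinned to 0 and the
  others confined to [-1, 1]; this puts the feasible set inside a compact product of intervals.
  Homogeneity then carries the maximum from unit vectors to every y orthogonal to q.\<close>

lemma quadratic_form_attains_max:
  assumes "\<exists>x. dot p q x = 0 \<and> dot p x x = 1"
  obtains x where "dot p q x = 0" "dot p x x = 1"
    "\<And>y. dot p q y = 0 \<Longrightarrow> bilinear_form p S y y \<le> bilinear_form p S x x * dot p y y"
proof -
  define U where "U = PiE UNIV (\<lambda>i. if i < p then {-1..1::real} else {0})"
  define V where "V = U \<inter> {x. dot p q x = 0 \<and> dot p x x = 1}"
  have "compactin (product_topology (\<lambda>i::nat. euclidean :: real topology) UNIV) U"
    unfolding U_def compactin_PiE by auto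
  then have "compact U"
    by (simp add: euclidean_product_topology)
  moreover have cont: "continuous_on UNIV (\<lambda>x. dot p q x)" "continuous_on UNIV (\<lambda>x. dot p x x)"
     "continuous_on UNIV (\<lambda>x. bilinear_form p S x x)"
    unfolding dot_def bilinear_form_def
    by (intro continuous_intros continuous_on_product_coordinates)+
  then have "closed {x. dot p q x = 0 \<and> dot p x x = 1}"
    by (intro closed_Collect_conj closed_Collect_eq) (auto intro!: continuous_intros)
  ultimately have "compact V" unfolding V_def by (rule compact_Int_closed)
  \<comment> \<open>Zeroing the coordinates from p on moves any feasible vector into
    \<open>V\<close> without changing \<open>dot\<close> or \<open>bilinear_form\<close>.\<close>
  have restr: "(\<lambda>i. if i < p then x i else 0) \<in> V" if "dot p q x = 0" "dot p x x = 1" for x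
  proof -
    have "\<bar>x i\<bar> \<le> 1" if "i < p" for i
    proof -
      have "x i * x i \<le> dot p x x" unfolding dot_def using that
        by (intro member_le_sum) auto
      then show ?thesis using \<open>dot p x x = 1\<close> by (simp add: abs_square_le_1[symmetric] power2_eq_square)
    qed
    then show ?thesis using that unfolding V_def U_def dot_def by (auto simp: abs_le_iff minus_le_iff)
  qed
  then have "V \<noteq> {}" using assms by blast
  then obtain x where x: "x \<in> V" and max: "\<And>y. y \<in> V \<Longrightarrow> bilinear_form p S y y \<le> bilinear_form p S x x"
    using continuous_attains_sup[OF \<open>compact V\<close> _ continuous_on_subset[OF cont(3)]] by blast
  have "bilinear_form p S y y \<le> bilinear_form p S x x * dot p y y" if y: "dot p q y = 0" for y
  proof (cases "dot p y y = 0")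
    case True
    then have "\<forall>i<p. y i = 0" by (simp add: dot_self_eq_0)
    then show ?thesis using True by (simp add: bilinear_form_def)
  next
    case False
    define c where "c = 1 / sqrt (dot p y y)"
    have pos: "dot p y y > 0" using False dot_self_nonneg[of p y] by linarith
    have c2: "c * c = 1 / dot p y y" using pos by (simp add: c_def)
    have "(\<lambda>i. if i < p then c * y i else 0) \<in> V"
    proof (rule restr)
      show "dot p q (\<lambda>i. c * y i) = 0" by (simp add: dot_scale y)
      show "dot p (\<lambda>i. c * y i) (\<lambda>i. c * y i) = 1"
        using pos by (simp add: dot_scale mult.assoc[symmetric] c2)
    qed
    from max[OF this] have "bilinear_form p S (\<lambda>i. c * y i) (\<lambda>i. c * y i) \<le> bilinear_form p S x x"
      by (simp add: bilinear_form_def cong: if_cong)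
    then have "bilinear_form p S y y / dot p y y \<le> bilinear_form p S x x"
      by (simp add: bilinear_form_scale mult.assoc[symmetric] c2)
    then show ?thesis using pos by (simp add: field_simps)
  qed
  then show ?thesis using that x by (auto simp: V_def)
qed

text \<open>The residual w = S x - \<mu> x is orthogonal to q, because S is symmetric and q is an
  eigenvector. Hence x + t w competes in the maximisation for every t, and the linear coefficient of
  the resulting inequality is twice the squared length of w, which must therefore vanish.\<close>

lemma rayleigh_max_eigenvector:
  assumes sym: "\<And>i j. i < p \<Longrightarrow> j < p \<Longrightarrow> S i j = S j i"
    and q: "\<And>i. i < p \<Longrightarrow> (\<Sum>j<p. S i j * q j) = \<nu> * q i"
    and x: "dot p q x = 0" "dot p x x = 1"
    and max: "\<And>y. dot p q y = 0 \<Longrightarrow> bilinear_form p S y y \<le> \<mu> * dot p y y"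
    and \<mu>: "\<mu> = bilinear_form p S x x"
    and i: "i < p"
  shows "(\<Sum>j<p. S i j * x j) = \<mu> * x i"
proof -
  define w where "w = (\<lambda>i. (\<Sum>j<p. S i j * x j) + (-\<mu>) * x i)"
  have yw: "bilinear_form p S y x = dot p y w + \<mu> * dot p y x" for y
    unfolding w_def dot_add dot_scale bilinear_form_eq_dot by simp
  have "dot p q w = bilinear_form p S q x" using yw[of q] x by simp
  also have "\<dots> = bilinear_form p S x q" by (rule bilinear_form_commute) (rule sym)
  also have "\<dots> = 0" using bilinear_form_eigenvector[of p S q \<nu> x] q x by (simp add: dot_commute)
  finally have qw: "dot p q w = 0" .
  have "2 * t * dot p w w + t\<^sup>2 * (bilinear_form p S w w - \<mu> * dot p w w) \<le> 0" for t
  proof -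
    have "dot p q (\<lambda>i. x i + t * w i) = 0" using qw x by (simp add: dot_add dot_scale)
    from max[OF this] have "bilinear_form p S x x + t * bilinear_form p S x w + t * bilinear_form p S w x + t * t * bilinear_form p S w w
      \<le> \<mu> * (dot p x x + 2 * t * dot p w x + t * t * dot p w w)"
      by (simp add: bilinear_form_add bilinear_form_scale dot_add dot_scale dot_commute[of p x w] algebra_simps)
    moreover have "bilinear_form p S x w = bilinear_form p S w x"
      by (rule bilinear_form_commute) (rule sym)
    ultimately show ?thesis using \<mu> x yw[of w]
      by (simp add: algebra_simps power2_eq_square)
  qed
  then have "dot p w w = 0" by (rule linear_coeff_zero)
  then show ?thesis using i by (auto simp: dot_self_eq_0 w_def)
qed

section \<open>Eigenvectors of a simple root, by triangularisation\<close>

text \<open>Back substitution from the last row upwards: entries left of the diagonal vanish,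
  coordinates further right are already known to be 0, and the diagonal entry differs from \<mu>.
  Only coordinate 0 can survive, so the eigenspace has dimension at most one.\<close>

lemma upper_triangular_kernel:
  assumes B: "B \<in> carrier_mat p p" "upper_triangular B"
    and z: "z \<in> carrier_vec p" "B *\<^sub>v z = \<mu> \<cdot>\<^sub>v z"
    and diag: "\<And>i. 0 < i \<Longrightarrow> i < p \<Longrightarrow> B $$ (i, i) \<noteq> (\<mu> :: real)"
    and i: "0 < i" "i < p"
  shows "z $ i = 0"
  using i
proof (induction "p - i" arbitrary: i rule: less_induct)
  case less
  have "\<mu> * z $ i = (\<Sum>j\<in>{0..<p}. B $$ (i, j) * z $ j)"
    using arg_cong[OF z(2), of "\<lambda>v. v $ i"] B(1) z(1) less.prems by (simp add: scalar_prod_def)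
  also have "\<dots> = (\<Sum>j\<in>{0..<p}. if j = i then B $$ (i, i) * z $ i else 0)"
  proof (intro sum.cong refl)
    fix j assume j: "j \<in> {0..<p}"
    consider "j < i" | "j = i" | "j > i" by linarith
    then show "B $$ (i, j) * z $ j = (if j = i then B $$ (i, i) * z $ i else 0)"
    proof cases
      case 1
      then show ?thesis using B less.prems by (auto dest: upper_triangularD)
    next
      case 3
      then have "z $ j = 0" using less j by auto
      then show ?thesis using 3 by simp
    qed simp
  qed
  also have "\<dots> = B $$ (i, i) * z $ i" using less.prems by simp
  finally show ?case using diag[of i] less.prems by simp
qed

text \<open>In Schur coordinates both vectors are concentrated in coordinate 0, so multiplying each
  by the first coordinate of the other makes them equal. Asking only for a nonzero pair of
  coefficients keeps the statement valid for zero vectors.\<close>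

lemma simple_root_eigenvectors_parallel:
  fixes A :: "real mat"
  assumes A: "A \<in> carrier_mat p p"
    and char: "char_poly A = (\<Prod>e\<leftarrow>es. [:- e, 1:])"
    and simple: "\<And>i. 0 < i \<Longrightarrow> i < length es \<Longrightarrow> es ! i \<noteq> \<mu>"
    and u: "u \<in> carrier_vec p" "A *\<^sub>v u = \<mu> \<cdot>\<^sub>v u"
    and v: "v \<in> carrier_vec p" "A *\<^sub>v v = \<mu> \<cdot>\<^sub>v v"
  obtains a b where "(a, b) \<noteq> (0, 0)" "a \<cdot>\<^sub>v u = b \<cdot>\<^sub>v v"
proof -
  obtain B P Q where "schur_decomposition A es = (B, P, Q)" by (metis prod_cases3)
  from schur_decomposition[OF A char this]
  have sim: "similar_mat_wit A B P Q" and ut: "upper_triangular B" and diag: "diag_mat B = es" by auto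
  note PQ = similar_mat_witD2[OF A sim]
  have len: "length es = p" using diag PQ by (auto simp: diag_mat_def)
  have Bd: "B $$ (i, i) = es ! i" if "i < p" for i
    using that diag PQ by (auto simp: diag_mat_def)
  have zero: "(Q *\<^sub>v x) $ i = 0" if x: "x \<in> carrier_vec p" "A *\<^sub>v x = \<mu> \<cdot>\<^sub>v x" and i: "0 < i" "i < p" for x i
  proof (rule upper_triangular_kernel[OF PQ(5) ut _ _ _ i])
    show "Q *\<^sub>v x \<in> carrier_vec p" using PQ x by auto
    have "Q *\<^sub>v (A *\<^sub>v x) = (Q * P) *\<^sub>v (B *\<^sub>v (Q *\<^sub>v x))"
      unfolding PQ(3) using PQ x
      by (smt (verit) assoc_mult_mat_vec mult_carrier_mat mult_mat_vec_carrier)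
    then have "Q *\<^sub>v (\<mu> \<cdot>\<^sub>v x) = B *\<^sub>v (Q *\<^sub>v x)" using PQ x by auto
    then show "B *\<^sub>v (Q *\<^sub>v x) = \<mu> \<cdot>\<^sub>v (Q *\<^sub>v x)" using PQ x by (simp add: mult_mat_vec)
    show "\<And>i. 0 < i \<Longrightarrow> i < p \<Longrightarrow> B $$ (i, i) \<noteq> \<mu>" using Bd simple len by auto
  qed
  define a b where "a = (Q *\<^sub>v v) $ 0" and "b = (Q *\<^sub>v u) $ 0"
  have "Q *\<^sub>v (a \<cdot>\<^sub>v u) = Q *\<^sub>v (b \<cdot>\<^sub>v v)"
  proof (intro eq_vecI)
    fix i assume "i < dim_vec (Q *\<^sub>v (b \<cdot>\<^sub>v v))"
    then have "i < p" using PQ by auto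
    then show "(Q *\<^sub>v (a \<cdot>\<^sub>v u)) $ i = (Q *\<^sub>v (b \<cdot>\<^sub>v v)) $ i"
      using PQ u v zero[of u i] zero[of v i] by (cases "i = 0") (auto simp: mult_mat_vec a_def b_def)
  qed auto
  then have "(P * Q) *\<^sub>v (a \<cdot>\<^sub>v u) = (P * Q) *\<^sub>v (b \<cdot>\<^sub>v v)"
    using PQ(6,7) u(1) v(1)
    by (metis assoc_mult_mat_vec smult_carrier_vec)
  then have eq: "a \<cdot>\<^sub>v u = b \<cdot>\<^sub>v v" using PQ(1) u(1) v(1) by simp
  show ?thesis
  proof (cases "(a, b) = (0, 0)")
    \<comment> \<open>Here the first coordinate of the transformed u vanishes along with all others,
      so u = 0 and the pair (1, 0) serves.\<close>
    case True
    have "Q *\<^sub>v u = 0\<^sub>v p"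
    proof (intro eq_vecI)
      fix i assume "i < dim_vec (0\<^sub>v p :: real vec)"
      then show "(Q *\<^sub>v u) $ i = 0\<^sub>v p $ i" using True zero[OF u, of i] by (cases "i = 0") (auto simp: b_def)
    qed (use PQ in auto)
    then have "(P * Q) *\<^sub>v u = 0\<^sub>v p"
      using PQ(6) by (auto simp: assoc_mult_mat_vec[OF PQ(6,7) u(1)] scalar_prod_def intro!: eq_vecI)
    then have "u = 0\<^sub>v p" using PQ(1) u(1) by simp
    then have "1 \<cdot>\<^sub>v u = 0 \<cdot>\<^sub>v v" using v by auto
    then show ?thesis using that[of 1 0] by auto
  qed (use that eq in blast)
qed

lemma mult_mat_vec_index_sum:
  assumes "A \<in> carrier_mat p p" "v \<in> carrier_vec p" "i < p"
  shows "(A *\<^sub>v v) $ i = (\<Sum>j<p. A $$ (i, j) * v $ j)"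
  using assms by (auto simp: scalar_prod_def lessThan_atLeast0)

text \<open>A maximiser of the Rayleigh quotient on the orthogonal complement of \<open>q\<close> is again an
  eigenvector. Its eigenvalue is not the top one: that is a simple root of the characteristic
  polynomial, so its eigenvectors are all parallel to \<open>q\<close>.\<close>

lemma second_rayleigh_bound:
  fixes A :: "real mat"
  assumes A: "A \<in> carrier_mat p p"
    and sym: "\<And>i j. i < p \<Longrightarrow> j < p \<Longrightarrow> A $$ (i, j) = A $$ (j, i)"
    and ev: "ordered_root_eigenvalues A \<phi>"
    and q: "eigenvector A q ((\<phi> 1)\<^sup>2)"
    and gap: "\<And>j. j \<in> {2..p} \<Longrightarrow> \<phi> 1 \<ge> \<phi> j + \<sigma>" "\<sigma> > 0"
    and v: "dot p (\<lambda>i. q $ i) v = 0"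
    and p: "p \<ge> 2"
  shows "bilinear_form p (\<lambda>i j. A $$ (i, j)) v v \<le> (\<phi> 1 - \<sigma>)\<^sup>2 * dot p v v"
proof (cases "dot p v v = 0")
  case True
  then have "\<forall>i<p. v i = 0" by (simp add: dot_self_eq_0)
  then show ?thesis using True by (simp add: bilinear_form_def)
next
  case False
  then have pos: "dot p v v > 0" using dot_self_nonneg[of p v] by linarith
  let ?S = "\<lambda>i j. A $$ (i, j)"
  have nn: "0 \<le> \<phi> j" if "j \<in> {1..p}" for j
    using ev that A unfolding ordered_root_eigenvalues_def by auto
  have q': "q \<in> carrier_vec p" "q \<noteq> 0\<^sub>v p" "A *\<^sub>v q = (\<phi> 1)\<^sup>2 \<cdot>\<^sub>v q"
    using q A by (auto simp: eigenvector_def)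
  define c where "c = 1 / sqrt (dot p v v)"
  have c2: "c * c = 1 / dot p v v" using pos by (simp add: c_def)
  have "dot p (\<lambda>i. q $ i) (\<lambda>i. c * v i) = 0 \<and> dot p (\<lambda>i. c * v i) (\<lambda>i. c * v i) = 1"
    using v pos by (simp add: dot_scale mult.assoc[symmetric] c2)
  then obtain x where x: "dot p (\<lambda>i. q $ i) x = 0" "dot p x x = 1"
    and max: "\<And>y. dot p (\<lambda>i. q $ i) y = 0 \<Longrightarrow> bilinear_form p ?S y y \<le> bilinear_form p ?S x x * dot p y y"
    using quadratic_form_attains_max[of p "\<lambda>i. q $ i" ?S] by blast
  define \<mu> where "\<mu> = bilinear_form p ?S x x"
  define y where "y = vec p x"
  have y: "y \<in> carrier_vec p" by (simp add: y_def)
  have qi: "(\<Sum>j<p. ?S i j * q $ j) = (\<phi> 1)\<^sup>2 * q $ i" if "i < p" for i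
    using mult_mat_vec_index_sum[OF A q'(1) that] q' that by simp
  have "(\<Sum>j<p. ?S i j * x j) = \<mu> * x i" if "i < p" for i
    by (rule rayleigh_max_eigenvector[OF sym qi x _ \<mu>_def that]) (use max \<mu>_def in auto)
  then have Ay: "A *\<^sub>v y = \<mu> \<cdot>\<^sub>v y"
    by (intro eq_vecI) (use A in \<open>auto simp: mult_mat_vec_index_sum[OF A y, unfolded y_def] y_def simp del: index_mult_mat_vec\<close>)
  have dy: "dot p (\<lambda>i. y $ i) (\<lambda>i. y $ i) = 1" "dot p (\<lambda>i. q $ i) (\<lambda>i. y $ i) = 0"
    using x by (simp_all add: dot_def y_def)
  have "y \<noteq> 0\<^sub>v p"
  proof
    assume "y = 0\<^sub>v p"
    then have "dot p (\<lambda>i. y $ i) (\<lambda>i. y $ i) = 0" by (simp add: dot_def)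
    then show False using dy by simp
  qed
  then have "eigenvalue A \<mu>" unfolding eigenvalue_def eigenvector_def using Ay y A by auto
  then have "poly (char_poly A) \<mu> = 0" using eigenvalue_root_char_poly[OF A] by simp
  moreover have cp: "char_poly A = (\<Prod>j\<in>{1..p}. [:- (\<phi> j)\<^sup>2, 1:])"
    using ev A unfolding ordered_root_eigenvalues_def by auto
  ultimately obtain j where j: "j \<in> {1..p}" "\<mu> = (\<phi> j)\<^sup>2"
    by (auto simp: poly_prod)
  define es where "es = map (\<lambda>j. (\<phi> j)\<^sup>2) [1..<Suc p]"
  have cp': "char_poly A = (\<Prod>e\<leftarrow>es. [:- e, 1:])"
  proof -
    have "(\<Prod>e\<leftarrow>es. [:- e, 1:]) = (\<Prod>j\<leftarrow>[1..<Suc p]. [:- (\<phi> j)\<^sup>2, 1:])"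
      by (simp add: es_def o_def del: upt_Suc)
    also have "\<dots> = (\<Prod>j\<in>set [1..<Suc p]. [:- (\<phi> j)\<^sup>2, 1:])"
      by (subst prod.distinct_set_conv_list) simp_all
    also have "\<dots> = (\<Prod>j\<in>{1..p}. [:- (\<phi> j)\<^sup>2, 1:])"
      by (simp only: set_upt atLeastLessThanSuc_atLeastAtMost)
    finally show ?thesis using cp by simp
  qed
  \<comment> \<open>The list \<open>es\<close> is indexed from 0 and \<open>\<phi>\<close> from 1,
    so entry i is the square of \<open>\<phi> (Suc i)\<close>. Nonnegativity of the roots is what
    lets the gap survive squaring.\<close>
  have simple: "es ! i \<noteq> (\<phi> 1)\<^sup>2" if "0 < i" "i < length es" for i
  proof -
    have i: "Suc i \<in> {2..p}" using that by (auto simp: es_def simp del: upt_Suc)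
    then have "\<phi> (Suc i) < \<phi> 1" "0 \<le> \<phi> (Suc i)" using gap(1)[OF i] gap(2) nn by auto
    then have "(\<phi> (Suc i))\<^sup>2 < (\<phi> 1)\<^sup>2" by (intro power_strict_mono) auto
    then show ?thesis using that by (auto simp: es_def simp del: upt_Suc)
  qed
  have "j \<noteq> 1"
  proof
    assume "j = 1"
    then have Ay': "A *\<^sub>v y = (\<phi> 1)\<^sup>2 \<cdot>\<^sub>v y" using j Ay by simp
    obtain a b where ab: "(a, b) \<noteq> (0, 0)" "a \<cdot>\<^sub>v q = b \<cdot>\<^sub>v y"
      by (rule simple_root_eigenvectors_parallel[OF A cp' simple q'(1,3) y Ay'])
    have abi: "a * q $ i = b * y $ i" if "i < p" for i
      using arg_cong[OF ab(2), of "\<lambda>v. v $ i"] that q'(1) y by simp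
    have "a * dot p (\<lambda>i. q $ i) (\<lambda>i. q $ i) = dot p (\<lambda>i. q $ i) (\<lambda>i. a * q $ i)" by (simp add: dot_scale)
    also have "\<dots> = dot p (\<lambda>i. q $ i) (\<lambda>i. b * y $ i)" by (simp add: dot_def abi)
    also have "\<dots> = 0" by (simp add: dot_scale dy)
    finally have 1: "a * dot p (\<lambda>i. q $ i) (\<lambda>i. q $ i) = 0" .
    have "dot p (\<lambda>i. q $ i) (\<lambda>i. q $ i) \<noteq> 0" using q' by (auto simp: dot_self_eq_0)
    then have "a = 0" using 1 by simp
    have "b * dot p (\<lambda>i. y $ i) (\<lambda>i. y $ i) = dot p (\<lambda>i. y $ i) (\<lambda>i. b * y $ i)" by (simp add: dot_scale)
    also have "\<dots> = dot p (\<lambda>i. y $ i) (\<lambda>i. a * q $ i)" by (simp add: dot_def abi)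
    finally have "b = 0" using \<open>a = 0\<close> dy by (simp add: dot_def)
    then show False using \<open>a = 0\<close> ab by simp
  qed
  then have "j \<in> {2..p}" using j by auto
  then have "0 \<le> \<phi> j" "\<phi> j \<le> \<phi> 1 - \<sigma>" using gap(1)[of j] nn[of j] by auto
  then have "\<mu> \<le> (\<phi> 1 - \<sigma>)\<^sup>2" using j by (simp add: power_mono)
  moreover have "bilinear_form p ?S v v \<le> \<mu> * dot p v v" using max[OF v] by (simp add: \<mu>_def)
  ultimately show ?thesis using pos by (meson dual_order.trans mult_right_mono order_less_imp_le)
qed

section \<open>Growth of the risk around the leading eigenvector\<close>

lemma bilinear_form_self_add:
  assumes "\<And>i j. i < p \<Longrightarrow> j < p \<Longrightarrow> S i j = S j i"
  shows "bilinear_form p S (\<lambda>i. x i + y i) (\<lambda>i. x i + y i)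
    = bilinear_form p S x x + 2 * bilinear_form p S x y + bilinear_form p S y y"
  using bilinear_form_commute[of p S y x, OF assms] by (simp add: bilinear_form_add)

text \<open>\<open>f\<close> is the risk (1/4) ||S - x x^T||_F^2 without its constant term. Write d
  = a q + w with w orthogonal to q; mixed terms vanish because q is an eigenvector. The part along q
  contributes ((\<phi> + a)^2 - \<phi>^2)^2 / 4, and the orthogonal part gains from (\<phi> + a)^2
  exceeding the Rayleigh bound (\<phi> - \<sigma>)^2.\<close>

lemma spiked_quadratic_growth:
  fixes S :: "nat \<Rightarrow> nat \<Rightarrow> real"
  assumes sym: "\<And>i j. i < p \<Longrightarrow> j < p \<Longrightarrow> S i j = S j i"
    and q: "\<And>i. i < p \<Longrightarrow> (\<Sum>j<p. S i j * q j) = \<phi>\<^sup>2 * q i" "dot p q q = 1"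
    and ray: "\<And>w. dot p q w = 0 \<Longrightarrow> bilinear_form p S w w \<le> (\<phi> - \<sigma>)\<^sup>2 * dot p w w"
    and const: "0 < \<eta>" "3 * \<eta> < \<sigma>" "\<sigma> \<le> \<phi>"
    and d: "dot p d d \<le> \<eta>\<^sup>2"
  defines "f \<equiv> \<lambda>x. (dot p x x)\<^sup>2 / 4 - bilinear_form p S x x / 2"
  shows "2 * \<eta>\<^sup>2 * dot p d d \<le> f (\<lambda>i. \<phi> * q i + d i) - f (\<lambda>i. \<phi> * q i)"
proof -
  define a where "a = dot p q d"
  define w where "w = (\<lambda>i. d i + (- a) * q i)"
  have qw: "dot p q w = 0" unfolding w_def dot_add dot_scale q a_def by simp
  define y where "y = dot p w w"
  define W where "W = bilinear_form p S w w"
  have d_eq: "d = (\<lambda>i. a * q i + w i)" by (simp add: w_def)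
  have Sqq: "bilinear_form p S q q = \<phi>\<^sup>2"
    using bilinear_form_eigenvector[of p S q "\<phi>\<^sup>2" q] q by simp
  have Swq: "bilinear_form p S w q = 0"
    using bilinear_form_eigenvector[of p S q "\<phi>\<^sup>2" w] q qw by (simp add: dot_commute)
  then have Sqw: "bilinear_form p S q w = 0"
    using bilinear_form_commute[of p S q w] sym by simp
  have dot_lin: "dot p (\<lambda>i. t * q i + w i) (\<lambda>i. t * q i + w i) = t\<^sup>2 + y" for t
    using qw q(2) by (simp add: dot_add dot_scale dot_commute[of p w q] y_def power2_eq_square)
  have form_lin: "bilinear_form p S (\<lambda>i. t * q i + w i) (\<lambda>i. t * q i + w i) = t\<^sup>2 * \<phi>\<^sup>2 + W" for t
    by (simp add: bilinear_form_add bilinear_form_scale Sqq Swq Sqw W_def power2_eq_square)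
  have dd: "dot p d d = a\<^sup>2 + y" unfolding d_eq by (rule dot_lin)
  have y0: "0 \<le> y" unfolding y_def by (rule dot_self_nonneg)
  have "a\<^sup>2 \<le> \<eta>\<^sup>2" using d dd y0 by linarith
  then have a: "\<bar>a\<bar> \<le> \<eta>" using const(1) by (metis abs_le_square_iff abs_of_pos)
  have W: "W \<le> (\<phi> - \<sigma>)\<^sup>2 * y" unfolding W_def y_def by (rule ray[OF qw])
  have eq1: "(\<lambda>i. \<phi> * q i + d i) = (\<lambda>i. (\<phi> + a) * q i + w i)"
    by (auto simp: d_eq algebra_simps)
  have f1: "f (\<lambda>i. \<phi> * q i + d i) = ((\<phi> + a)\<^sup>2 + y)\<^sup>2 / 4 - ((\<phi> + a)\<^sup>2 * \<phi>\<^sup>2 + W) / 2"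
    unfolding f_def eq1 dot_lin form_lin ..
  have f0: "f (\<lambda>i. \<phi> * q i) = (\<phi>\<^sup>2)\<^sup>2 / 4 - (\<phi>\<^sup>2 * \<phi>\<^sup>2) / 2"
    by (simp add: f_def dot_scale bilinear_form_scale q Sqq power2_eq_square)
  \<comment> \<open>From \<phi> >= \<sigma> > 3 \<eta> and |a| <= \<eta> follows 2 \<phi> + a >= 5
    \<eta>.\<close>
  have "(5 * \<eta>)\<^sup>2 \<le> (2 * \<phi> + a)\<^sup>2" using a const by (intro power_mono) auto
  then have 1: "25 * \<eta>\<^sup>2 * a\<^sup>2 \<le> ((\<phi> + a)\<^sup>2 - \<phi>\<^sup>2)\<^sup>2"
    using mult_left_mono[of "(5 * \<eta>)\<^sup>2" "(2 * \<phi> + a)\<^sup>2" "a\<^sup>2"]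
    by (simp add: power2_eq_square algebra_simps)
  have "(\<phi> - \<eta>)\<^sup>2 \<le> (\<phi> + a)\<^sup>2" using a const by (intro power_mono) auto
  moreover have "(\<phi> - \<sigma>)\<^sup>2 \<le> (\<phi> - 3 * \<eta>)\<^sup>2" using const by (intro power_mono) auto
  \<comment> \<open>The right-hand side equals 4 \<eta> \<phi> - 8 \<eta>^2, and \<phi> >= 3 \<eta>
    leaves at least 4 \<eta>^2.\<close>
  moreover have "4 * \<eta>\<^sup>2 \<le> (\<phi> - \<eta>)\<^sup>2 - (\<phi> - 3 * \<eta>)\<^sup>2"
  proof -
    have "\<eta> * (3 * \<eta>) \<le> \<eta> * \<phi>" using const by (intro mult_left_mono) auto
    then show ?thesis by (simp add: power2_eq_square algebra_simps)
  qed
  ultimately have "4 * \<eta>\<^sup>2 \<le> (\<phi> + a)\<^sup>2 - (\<phi> - \<sigma>)\<^sup>2" by linarith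
  from mult_right_mono[OF this y0] have 2: "4 * \<eta>\<^sup>2 * y \<le> (\<phi> + a)\<^sup>2 * y - (\<phi> - \<sigma>)\<^sup>2 * y"
    by (simp add: algebra_simps)
  have "f (\<lambda>i. \<phi> * q i + d i) - f (\<lambda>i. \<phi> * q i)
    = ((\<phi> + a)\<^sup>2 - \<phi>\<^sup>2)\<^sup>2 / 4 + (\<phi> + a)\<^sup>2 * y / 2 + y\<^sup>2 / 4 - W / 2"
    unfolding f1 f0 by (simp add: power2_eq_square field_simps)
  moreover have "0 \<le> \<eta>\<^sup>2 * a\<^sup>2" "0 \<le> y\<^sup>2" by simp_all
  moreover have "2 * \<eta>\<^sup>2 * dot p d d = 2 * (\<eta>\<^sup>2 * a\<^sup>2) + 2 * (\<eta>\<^sup>2 * y)"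
    unfolding dd by (simp add: algebra_simps)
  ultimately show ?thesis using 1 2 W by linarith
qed

section \<open>Norm inequalities and transfer from the empirical to the population risk\<close>

lemma bilinear_form_Cauchy_Schwarz:
  "\<bar>bilinear_form p S x y\<bar> \<le> sqrt (\<Sum>i<p. \<Sum>j<p. (S i j)\<^sup>2) * sqrt (dot p x x) * sqrt (dot p y y)"
proof -
  have "bilinear_form p S x y = (\<Sum>(i, j)\<in>{..<p} \<times> {..<p}. S i j * (x i * y j))"
    by (simp add: bilinear_form_def sum.cartesian_product mult_ac)
  then have "(bilinear_form p S x y)\<^sup>2 \<le> (\<Sum>(i, j)\<in>{..<p} \<times> {..<p}. (S i j)\<^sup>2) * (\<Sum>(i, j)\<in>{..<p} \<times> {..<p}. (x i * y j)\<^sup>2)"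
    using Cauchy_Schwarz_ineq_sum[of "\<lambda>(i, j). S i j" "\<lambda>(i, j). x i * y j" "{..<p} \<times> {..<p}"]
    by (simp add: case_prod_unfold)
  also have "(\<Sum>(i, j)\<in>{..<p} \<times> {..<p}. (x i * y j)\<^sup>2) = dot p x x * dot p y y"
    by (simp add: dot_def sum_product sum.cartesian_product power_mult_distrib power2_eq_square mult_ac)
  finally have "sqrt ((bilinear_form p S x y)\<^sup>2) \<le> sqrt ((\<Sum>(i, j)\<in>{..<p} \<times> {..<p}. (S i j)\<^sup>2) * (dot p x x * dot p y y))"
    by (rule real_sqrt_le_mono)
  then show ?thesis by (simp add: real_sqrt_mult sum.cartesian_product mult_ac)
qed

lemma l2_norm_eq_dot: "v \<in> carrier_vec p \<Longrightarrow> l2_norm v = sqrt (dot p (\<lambda>i. v $ i) (\<lambda>i. v $ i))"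
  by (simp add: l2_norm_def dot_def power2_eq_square)

lemma sqrt_dot_triangle:
  "sqrt (dot p (\<lambda>i. x i + y i) (\<lambda>i. x i + y i)) \<le> sqrt (dot p x x) + sqrt (dot p y y)"
  using L2_set_triangle_ineq[of x y "{..<p}"] by (simp add: L2_set_def dot_def power2_eq_square)

lemma l1_norm_triangle:
  assumes "u \<in> carrier_vec p" "v \<in> carrier_vec p"
  shows "l1_norm u \<le> l1_norm v + l1_norm (v - u)"
proof -
  have "(\<Sum>j<p. \<bar>u $ j\<bar>) \<le> (\<Sum>j<p. \<bar>v $ j\<bar> + \<bar>v $ j - u $ j\<bar>)" by (intro sum_mono) auto
  then show ?thesis using assms by (simp add: l1_norm_def sum.distrib)
qed

lemma l1_norm_le_l2_norm:
  "l1_norm v \<le> sqrt (real (dim_vec v)) * l2_norm v"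
proof -
  have "(\<Sum>j<dim_vec v. \<bar>v $ j\<bar> * 1)\<^sup>2 \<le> (\<Sum>j<dim_vec v. \<bar>v $ j\<bar>\<^sup>2) * (\<Sum>j<dim_vec v. 1\<^sup>2)"
    by (rule Cauchy_Schwarz_ineq_sum)
  then have "(l1_norm v)\<^sup>2 \<le> real (dim_vec v) * (\<Sum>j<dim_vec v. (v $ j)\<^sup>2)"
    by (simp add: l1_norm_def mult_ac)
  then have "l1_norm v \<le> sqrt (real (dim_vec v) * (\<Sum>j<dim_vec v. (v $ j)\<^sup>2))"
    by (rule real_le_rsqrt)
  then show ?thesis by (simp add: l2_norm_def real_sqrt_mult)
qed

lemma l1_norm_nonneg: "0 \<le> l1_norm v"
  by (simp add: l1_norm_def sum_nonneg)

lemma l2_norm_nonneg: "0 \<le> l2_norm v"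
  by (simp add: l2_norm_def sum_nonneg)

lemma l2_norm_le_l1_norm: "l2_norm v \<le> l1_norm v"
  using L2_set_le_sum_abs[of "\<lambda>j. v $ j" "{..<dim_vec v}"] by (simp add: l2_norm_def l1_norm_def L2_set_def)

lemma frobenius_norm_diff_outer:
  assumes "A \<in> carrier_mat p p" "v \<in> carrier_vec p"
  shows "(frobenius_norm (A - outer v))\<^sup>2 = (\<Sum>i<p. \<Sum>j<p. (A $$ (i, j))\<^sup>2)
    - 2 * bilinear_form p (\<lambda>i j. A $$ (i, j)) (\<lambda>i. v $ i) (\<lambda>i. v $ i)
    + (dot p (\<lambda>i. v $ i) (\<lambda>i. v $ i))\<^sup>2"
proof -
  have "(frobenius_norm (A - outer v))\<^sup>2 = (\<Sum>i<p. \<Sum>j<p. (A $$ (i, j) - v $ i * v $ j)\<^sup>2)"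
    using assms by (simp add: frobenius_norm_def outer_def sum_nonneg)
  also have "\<dots> = (\<Sum>i<p. \<Sum>j<p. (A $$ (i, j))\<^sup>2 - 2 * (A $$ (i, j) * v $ i * v $ j) + (v $ i * v $ i) * (v $ j * v $ j))"
    by (intro sum.cong refl) (simp add: power2_eq_square algebra_simps)
  also have "\<dots> = (\<Sum>i<p. \<Sum>j<p. (A $$ (i, j))\<^sup>2)
    - 2 * bilinear_form p (\<lambda>i j. A $$ (i, j)) (\<lambda>i. v $ i) (\<lambda>i. v $ i)
    + (dot p (\<lambda>i. v $ i) (\<lambda>i. v $ i))\<^sup>2"
    by (simp add: sum.distrib sum_subtractf bilinear_form_def dot_def power2_eq_square[of "sum _ _"] sum_product sum_distrib_left[symmetric])
  finally show ?thesis .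
qed

text \<open>Minimality compares \<beta> with \<beta>0 in the empirical objective. Passing to the
  population risk costs a difference of quadratic forms of H - A, and the penalties differ by at
  most \<open>lam\<close> times sqrt p times the error r. Each of these costs carries a factor r,
  while the risk grows like r^2, so one factor cancels and the bound is linear in r.\<close>

lemma lasso_error_bound:
  fixes A H :: "real mat"
  assumes A: "A \<in> carrier_mat p p" and H: "H \<in> carrier_mat p p"
    and symA: "\<And>i j. i < p \<Longrightarrow> j < p \<Longrightarrow> A $$ (i, j) = A $$ (j, i)"
    and symH: "\<And>i j. i < p \<Longrightarrow> j < p \<Longrightarrow> H $$ (i, j) = H $$ (j, i)"
    and ev: "ordered_root_eigenvalues A \<phi>"
    and q: "eigenvector A q ((\<phi> 1)\<^sup>2)" "l2_norm q = 1"
    and \<beta>0: "\<beta>0 = \<phi> 1 \<cdot>\<^sub>v q"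
    and gap: "\<And>j. j \<in> {2..p} \<Longrightarrow> \<phi> 1 \<ge> \<phi> j + \<sigma>" and \<sigma>: "3 * \<eta> < \<sigma>" and \<eta>: "0 < \<eta>"
    and p: "p \<ge> 2"
    and lam: "lam \<ge> 0"
    and \<beta>: "\<beta> \<in> carrier_vec p" "l2_norm (\<beta> - \<beta>0) \<le> \<eta>"
    and min: "lasso_objective H lam \<beta> \<le> lasso_objective H lam \<beta>0"
  shows "2 * \<eta>\<^sup>2 * l2_norm (\<beta> - \<beta>0) \<le> 3 / 2 * \<phi> 1 * frobenius_norm (H - A) + lam * sqrt (real p)"
proof -
  let ?S = "\<lambda>i j. A $$ (i, j)" and ?T = "\<lambda>i j. H $$ (i, j)" and ?D = "\<lambda>i j. (H - A) $$ (i, j)"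
  define Q where "Q = (\<lambda>i. q $ i)"
  define d where "d = (\<lambda>i. (\<beta> - \<beta>0) $ i)"
  define x0 where "x0 = (\<lambda>i. \<phi> 1 * Q i)"
  define x where "x = (\<lambda>i. x0 i + d i)"
  define r where "r = sqrt (dot p d d)"
  have q': "q \<in> carrier_vec p" "A *\<^sub>v q = (\<phi> 1)\<^sup>2 \<cdot>\<^sub>v q"
    using q A by (auto simp: eigenvector_def)
  have c0: "\<beta>0 \<in> carrier_vec p" using q' \<beta>0 by simp
  have r: "l2_norm (\<beta> - \<beta>0) = r"
    unfolding r_def d_def using \<beta> c0 by (intro l2_norm_eq_dot) auto
  have r0: "0 \<le> r" and r2: "dot p d d = r\<^sup>2" unfolding r_def using dot_self_nonneg[of p d] by auto
  have QQ: "dot p Q Q = 1"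
    using q(2) q'(1) dot_self_nonneg[of p Q] by (simp add: l2_norm_eq_dot Q_def)
  \<comment> \<open>p >= 2 guarantees a second root; it is nonnegative, so the gap bounds \<phi> 1
    from below by \<sigma>.\<close>
  have \<phi>: "\<sigma> \<le> \<phi> 1"
  proof -
    have "0 \<le> \<phi> 2" using ev A p unfolding ordered_root_eigenvalues_def by auto
    then show ?thesis using gap[of 2] p by auto
  qed
  have SQ: "(\<Sum>j<p. ?S i j * Q j) = (\<phi> 1)\<^sup>2 * Q i" if "i < p" for i
    using mult_mat_vec_index_sum[OF A q'(1) that] q' that by (simp add: Q_def)
  have "2 * \<eta>\<^sup>2 * dot p d d \<le> ((dot p x x)\<^sup>2 / 4 - bilinear_form p ?S x x / 2)
      - ((dot p x0 x0)\<^sup>2 / 4 - bilinear_form p ?S x0 x0 / 2)"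
    unfolding x_def x0_def
  proof (rule spiked_quadratic_growth[OF symA SQ QQ _ \<eta> \<sigma> \<phi>])
    show "bilinear_form p ?S w w \<le> (\<phi> 1 - \<sigma>)\<^sup>2 * dot p w w" if "dot p Q w = 0" for w
      using that \<sigma> \<eta> unfolding Q_def
      by (intro second_rayleigh_bound[OF A symA ev q(1) gap _ _ p]) auto
    show "dot p d d \<le> \<eta>\<^sup>2" using \<beta>(2) r r0 r2 \<eta> by (simp add: power_mono)
  qed
  moreover have lasso: "lasso_objective H lam v = 1 / 4 * (\<Sum>i<p. \<Sum>j<p. (?T i j)\<^sup>2)
      + (dot p (\<lambda>i. v $ i) (\<lambda>i. v $ i))\<^sup>2 / 4
      - bilinear_form p ?T (\<lambda>i. v $ i) (\<lambda>i. v $ i) / 2 + lam * l1_norm v"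
    if "v \<in> carrier_vec p" for v
    unfolding lasso_objective_def frobenius_norm_diff_outer[OF H that] by simp
  have xeq: "x i = \<beta> $ i" "x0 i = \<beta>0 $ i" if "i < p" for i
    using that \<beta>(1) q'(1) by (auto simp: x_def x0_def d_def \<beta>0 Q_def)
  have "dot p (\<lambda>i. \<beta> $ i) (\<lambda>i. \<beta> $ i) = dot p x x" "dot p (\<lambda>i. \<beta>0 $ i) (\<lambda>i. \<beta>0 $ i) = dot p x0 x0"
    "bilinear_form p ?T (\<lambda>i. \<beta> $ i) (\<lambda>i. \<beta> $ i) = bilinear_form p ?T x x"
    "bilinear_form p ?T (\<lambda>i. \<beta>0 $ i) (\<lambda>i. \<beta>0 $ i) = bilinear_form p ?T x0 x0"
    by (simp_all add: dot_def bilinear_form_def xeq)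
  then have "(dot p x x)\<^sup>2 / 4 - bilinear_form p ?T x x / 2 + lam * l1_norm \<beta>
      \<le> (dot p x0 x0)\<^sup>2 / 4 - bilinear_form p ?T x0 x0 / 2 + lam * l1_norm \<beta>0"
    using min by (simp add: lasso[OF \<beta>(1)] lasso[OF c0])
  moreover have "lam * l1_norm \<beta>0 \<le> lam * l1_norm \<beta> + lam * (sqrt (real p) * r)"
  proof -
    have "l1_norm (\<beta> - \<beta>0) \<le> sqrt (real p) * r"
      using l1_norm_le_l2_norm[of "\<beta> - \<beta>0"] c0 r by simp
    then have "l1_norm \<beta>0 \<le> l1_norm \<beta> + sqrt (real p) * r"
      using l1_norm_triangle[OF c0 \<beta>(1)] by linarith
    from mult_left_mono[OF this lam] show ?thesis by (simp add: algebra_simps)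
  qed
  moreover have "bilinear_form p ?T x x - bilinear_form p ?T x0 x0
      - (bilinear_form p ?S x x - bilinear_form p ?S x0 x0) \<le> frobenius_norm (H - A) * r * (3 * \<phi> 1)"
  proof -
    have diff: "bilinear_form p ?T y z - bilinear_form p ?S y z = bilinear_form p ?D y z" for y z
      using A H unfolding bilinear_form_def sum_subtractf[symmetric]
      by (intro sum.cong refl) (auto simp: algebra_simps)
    \<comment> \<open>By symmetry of D = H - A, the forms at x0 + d and x0 differ by the form of D
      at d and d + 2 x0. This isolates one factor d.\<close>
    define z where "z = (\<lambda>i. d i + 2 * x0 i)"
    have symD: "?D i j = ?D j i" if "i < p" "j < p" for i j
      using that A H symA[OF that] symH[OF that] by simp
    have "bilinear_form p ?D x x - bilinear_form p ?D x0 x0 = bilinear_form p ?D d z"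
      unfolding x_def bilinear_form_self_add[of p ?D, OF symD]
      using bilinear_form_commute[of p ?D d x0, OF symD]
      by (simp add: z_def bilinear_form_add bilinear_form_scale)
    also have "\<dots> \<le> sqrt (\<Sum>i<p. \<Sum>j<p. (?D i j)\<^sup>2) * r * sqrt (dot p z z)"
      using bilinear_form_Cauchy_Schwarz[of p ?D d z] unfolding r_def by linarith
    also have "sqrt (\<Sum>i<p. \<Sum>j<p. (?D i j)\<^sup>2) = frobenius_norm (H - A)"
      using A H by (simp add: frobenius_norm_def)
    also have "frobenius_norm (H - A) * r * sqrt (dot p z z) \<le> frobenius_norm (H - A) * r * (3 * \<phi> 1)"
    proof (rule mult_left_mono)
      \<comment> \<open>The vector x0 has length \<phi> 1, and r <= \<eta> < \<phi> 1, which gives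
        the constant 3.\<close>
      have "sqrt (dot p z z) \<le> r + 2 * \<phi> 1"
        using sqrt_dot_triangle[of p d "\<lambda>i. 2 * x0 i"] QQ \<phi> \<sigma> \<eta>
        by (simp add: z_def r_def x0_def dot_scale real_sqrt_mult)
      then show "sqrt (dot p z z) \<le> 3 * \<phi> 1" using \<phi> \<sigma> \<eta> \<beta>(2) r by simp
      show "0 \<le> frobenius_norm (H - A) * r" using r0 by (simp add: frobenius_norm_def sum_nonneg)
    qed
    finally show ?thesis using diff[of x x] diff[of x0 x0] by linarith
  qed
  ultimately have "2 * \<eta>\<^sup>2 * dot p d d \<le> 1 / 2 * (frobenius_norm (H - A) * r * (3 * \<phi> 1)) + lam * (sqrt (real p) * r)"
    by argo
  then have "r * (2 * \<eta>\<^sup>2 * r) \<le> r * (3 / 2 * \<phi> 1 * frobenius_norm (H - A) + lam * sqrt (real p))"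
    unfolding r2 by (simp add: power2_eq_square algebra_simps)
  moreover have "0 \<le> 3 / 2 * \<phi> 1 * frobenius_norm (H - A) + lam * sqrt (real p)"
    using \<phi> \<sigma> \<eta> lam by (intro add_nonneg_nonneg mult_nonneg_nonneg) (auto simp: frobenius_norm_def sum_nonneg)
  ultimately show ?thesis unfolding r using r0
    by (cases "r = 0") auto
qed

section \<open>Covariance inequality under absolute regularity\<close>

text \<open>The mixing condition for one fixed pair of sigma-algebras, quantified over partitions so
  that no supremum has to be handled.\<close>

definition dependence_bound :: "'a measure \<Rightarrow> 'a measure \<Rightarrow> 'a measure \<Rightarrow> real \<Rightarrow> bool" where
  "dependence_bound M F G b \<longleftrightarrow>
     (\<forall>\<A> \<B>. finite \<A> \<and> partition_on (space M) \<A> \<and> \<A> \<subseteq> sets F \<and>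
        finite \<B> \<and> partition_on (space M) \<B> \<and> \<B> \<subseteq> sets G \<longrightarrow>
        1 / 2 * (\<Sum>A\<in>\<A>. \<Sum>B\<in>\<B>. \<bar>measure M (A \<inter> B) - measure M A * measure M B\<bar>) \<le> b)"

lemma partition_on_level_sets:
  "partition_on S ((\<lambda>x. f -` {x} \<inter> S) ` (f ` S))"
  by (auto simp: partition_on_def disjoint_def)

lemma inj_on_level_sets: "inj_on (\<lambda>x. f -` {x} \<inter> S) (f ` S)"
  by (auto simp: inj_on_def)

lemma level_set_decomposition:
  fixes f :: "'a \<Rightarrow> real"
  assumes "finite (f ` S)" "\<omega> \<in> S"
  shows "f \<omega> = (\<Sum>x\<in>f ` S. x * indicator (f -` {x} \<inter> S) \<omega>)"
proof -
  have "(\<Sum>x\<in>f ` S. x * indicator (f -` {x} \<inter> S) \<omega>) = (\<Sum>x\<in>f ` S. if x = f \<omega> then x else 0)"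
    using assms by (intro sum.cong) (auto simp: indicator_def)
  then show ?thesis using assms by simp
qed

text \<open>The level sets of f and g form partitions of the kind tested by
  \<open>dependence_bound\<close>. The covariance is the sum, over pairs of values, of their product
  times the dependence of the two level sets. The weights are at most A^2, and the factor 2 undoes
  the 1/2 in the mixing coefficient.\<close>

lemma (in prob_space) covariance_simple_functions:
  assumes sub: "subalgebra M F" "subalgebra M G"
    and dep: "dependence_bound M F G b"
    and f: "f \<in> borel_measurable F" "finite (f ` space M)" "\<And>\<omega>. \<omega> \<in> space M \<Longrightarrow> \<bar>f \<omega>\<bar> \<le> A"
    and g: "g \<in> borel_measurable G" "finite (g ` space M)" "\<And>\<omega>. \<omega> \<in> space M \<Longrightarrow> \<bar>g \<omega>\<bar> \<le> A"
  shows "\<bar>expectation (\<lambda>\<omega>. f \<omega> * g \<omega>) - expectation f * expectation g\<bar> \<le> 2 * b * A\<^sup>2"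
proof -
  have sp: "space F = space M" "space G = space M" and sets: "sets F \<subseteq> events" "sets G \<subseteq> events"
    using sub by (auto simp: subalgebra_def)
  let ?X = "f ` space M" and ?Y = "g ` space M"
  let ?P = "\<lambda>x. f -` {x} \<inter> space M" and ?Q = "\<lambda>y. g -` {y} \<inter> space M"
  have PF: "?P x \<in> sets F" for x using measurable_sets[OF f(1) borel_singleton[OF sets.empty_sets, of x]] unfolding sp .
  have QG: "?Q y \<in> sets G" for y using measurable_sets[OF g(1) borel_singleton[OF sets.empty_sets, of y]] unfolding sp .
  have PM: "?P x \<in> events" for x by (rule subsetD[OF sets(1) PF])
  have QM: "?Q y \<in> events" for y by (rule subsetD[OF sets(2) QG])
  have int: "integrable M (indicator E :: 'a \<Rightarrow> real)" if "E \<in> events" for E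
    using that by (rule integrable_real_indicator) (simp add: less_top[symmetric])
  have Ef: "expectation f = (\<Sum>x\<in>?X. x * prob (?P x))"
  proof -
    have "expectation f = expectation (\<lambda>\<omega>. \<Sum>x\<in>?X. x * indicator (?P x) \<omega>)"
      by (intro Bochner_Integration.integral_cong refl level_set_decomposition f(2))
    also have "\<dots> = (\<Sum>x\<in>?X. expectation (\<lambda>\<omega>. x * indicator (?P x) \<omega>))"
      by (rule Bochner_Integration.integral_sum) (intro integrable_mult_right int PM)
    finally show ?thesis by (simp add: PM)
  qed
  have Eg: "expectation g = (\<Sum>y\<in>?Y. y * prob (?Q y))"
  proof -
    have "expectation g = expectation (\<lambda>\<omega>. \<Sum>y\<in>?Y. y * indicator (?Q y) \<omega>)"
      by (intro Bochner_Integration.integral_cong refl level_set_decomposition g(2))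
    also have "\<dots> = (\<Sum>x\<in>?Y. expectation (\<lambda>\<omega>. x * indicator (?Q x) \<omega>))"
      by (rule Bochner_Integration.integral_sum) (intro integrable_mult_right int QM)
    finally show ?thesis by (simp add: QM)
  qed
  have Efg: "expectation (\<lambda>\<omega>. f \<omega> * g \<omega>) = (\<Sum>x\<in>?X. \<Sum>y\<in>?Y. x * y * prob (?P x \<inter> ?Q y))"
  proof -
    have "expectation (\<lambda>\<omega>. f \<omega> * g \<omega>)
      = expectation (\<lambda>\<omega>. \<Sum>x\<in>?X. \<Sum>y\<in>?Y. (x * y) * indicator (?P x \<inter> ?Q y) \<omega>)"
    proof (intro Bochner_Integration.integral_cong refl)
      fix \<omega> assume \<omega>: "\<omega> \<in> space M"
      show "f \<omega> * g \<omega> = (\<Sum>x\<in>?X. \<Sum>y\<in>?Y. (x * y) * indicator (?P x \<inter> ?Q y) \<omega>)"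
      proof -
        have "f \<omega> * g \<omega> = (\<Sum>x\<in>?X. x * indicator (?P x) \<omega>) * (\<Sum>y\<in>?Y. y * indicator (?Q y) \<omega>)"
          using level_set_decomposition[OF f(2) \<omega>] level_set_decomposition[OF g(2) \<omega>] by presburger
        also have "\<dots> = (\<Sum>x\<in>?X. \<Sum>y\<in>?Y. (x * y) * indicator (?P x \<inter> ?Q y) \<omega>)"
          unfolding sum_product by (intro sum.cong refl) (simp add: indicator_inter_arith)
        finally show ?thesis .
      qed
    qed
    also have "\<dots> = (\<Sum>x\<in>?X. expectation (\<lambda>\<omega>. \<Sum>y\<in>?Y. (x * y) * indicator (?P x \<inter> ?Q y) \<omega>))"
      by (rule Bochner_Integration.integral_sum)
        (intro Bochner_Integration.integrable_sum integrable_mult_right int sets.Int PM QM)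
    also have "\<dots> = (\<Sum>x\<in>?X. \<Sum>y\<in>?Y. expectation (\<lambda>\<omega>. (x * y) * indicator (?P x \<inter> ?Q y) \<omega>))"
      by (intro sum.cong refl Bochner_Integration.integral_sum integrable_mult_right int sets.Int PM QM)
    finally show ?thesis by (simp add: PM QM sets.Int)
  qed
  have A0: "\<bar>x * y\<bar> \<le> A\<^sup>2" if "x \<in> ?X" "y \<in> ?Y" for x y
  proof -
    have "\<bar>x\<bar> \<le> A" "\<bar>y\<bar> \<le> A" using that f g by auto
    then have "\<bar>x\<bar> * \<bar>y\<bar> \<le> A * A" by (intro mult_mono) auto
    then show ?thesis by (simp add: abs_mult power2_eq_square)
  qed
  define \<delta> where "\<delta> = (\<lambda>x y. prob (?P x \<inter> ?Q y) - prob (?P x) * prob (?Q y))"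
  have "expectation (\<lambda>\<omega>. f \<omega> * g \<omega>) - expectation f * expectation g
      = (\<Sum>x\<in>?X. \<Sum>y\<in>?Y. x * y * \<delta> x y)"
    unfolding Ef Eg Efg sum_product sum_subtractf[symmetric] \<delta>_def
    by (intro sum.cong refl) (simp add: algebra_simps)
  also have "\<bar>\<Sum>x\<in>?X. \<Sum>y\<in>?Y. x * y * \<delta> x y\<bar> \<le> (\<Sum>x\<in>?X. \<bar>\<Sum>y\<in>?Y. x * y * \<delta> x y\<bar>)"
    by (rule sum_abs)
  also have "\<dots> \<le> (\<Sum>x\<in>?X. \<Sum>y\<in>?Y. \<bar>x * y * \<delta> x y\<bar>)"
    by (rule sum_mono) (rule sum_abs)
  also have "\<dots> \<le> (\<Sum>x\<in>?X. \<Sum>y\<in>?Y. A\<^sup>2 * \<bar>\<delta> x y\<bar>)"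
  proof (rule sum_mono, rule sum_mono)
    fix x y assume "x \<in> ?X" "y \<in> ?Y"
    from A0[OF this] show "\<bar>x * y * \<delta> x y\<bar> \<le> A\<^sup>2 * \<bar>\<delta> x y\<bar>"
      unfolding abs_mult[of "x * y"] by (rule mult_right_mono) simp
  qed
  also have "\<dots> = A\<^sup>2 * (\<Sum>E\<in>?P ` ?X. \<Sum>H\<in>?Q ` ?Y. \<bar>prob (E \<inter> H) - prob E * prob H\<bar>)"
  proof -
    have "(\<Sum>E\<in>?P ` ?X. h E) = (\<Sum>x\<in>?X. h (?P x))" for h :: "'a set \<Rightarrow> real"
      using sum.reindex[OF inj_on_level_sets[of f "space M"], of h] by (simp only: o_def)
    moreover have "(\<Sum>E\<in>?Q ` ?Y. h E) = (\<Sum>y\<in>?Y. h (?Q y))" for h :: "'a set \<Rightarrow> real"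
      using sum.reindex[OF inj_on_level_sets[of g "space M"], of h] by (simp only: o_def)
    ultimately show ?thesis by (simp only: sum_distrib_left \<delta>_def)
  qed
  also have "\<dots> \<le> A\<^sup>2 * (2 * b)"
  proof (rule mult_left_mono)
    have "1 / 2 * (\<Sum>E\<in>?P ` ?X. \<Sum>H\<in>?Q ` ?Y. \<bar>prob (E \<inter> H) - prob E * prob H\<bar>) \<le> b"
      by (rule dep[unfolded dependence_bound_def, THEN spec, THEN spec, THEN mp])
        (intro conjI image_subsetI finite_imageI f(2) g(2) partition_on_level_sets PF QG)
    then show "(\<Sum>E\<in>?P ` ?X. \<Sum>H\<in>?Q ` ?Y. \<bar>prob (E \<inter> H) - prob E * prob H\<bar>) \<le> 2 * b" by simp
  qed simp
  finally show ?thesis by (simp add: mult_ac)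
qed

section \<open>From finitely many values to bounded functions\<close>

text \<open>Rounding to a grid gives a bounded function finite range. It acts on values only, so
  measurability with respect to the smaller sigma-algebras is preserved.\<close>

definition round_down :: "nat \<Rightarrow> real \<Rightarrow> real" where
  "round_down n x = of_int \<lfloor>real (Suc n) * x\<rfloor> / real (Suc n)"

lemma round_down_diff: "\<bar>round_down n x - x\<bar> \<le> 1 / real (Suc n)"
proof -
  let ?k = "of_int \<lfloor>real (Suc n) * x\<rfloor> :: real"
  have "?k \<le> real (Suc n) * x" "real (Suc n) * x < ?k + 1" by linarith+
  then have "\<bar>?k - real (Suc n) * x\<bar> \<le> 1" by linarith
  moreover have "\<bar>round_down n x - x\<bar> = \<bar>?k - real (Suc n) * x\<bar> / real (Suc n)"
    unfolding round_down_def by (simp add: field_simps abs_divide[symmetric] del: of_nat_Suc)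
  ultimately show ?thesis by (simp add: divide_right_mono del: of_nat_Suc)
qed

lemma round_down_bound: "\<bar>x\<bar> \<le> A \<Longrightarrow> \<bar>round_down n x\<bar> \<le> A + 1"
proof -
  assume "\<bar>x\<bar> \<le> A"
  moreover have "1 / real (Suc n) \<le> 1" by simp
  ultimately show ?thesis using round_down_diff[of n x] by linarith
qed

lemma round_down_tendsto: "(\<lambda>n. round_down n x) \<longlonglongrightarrow> x"
proof (rule LIM_zero_cancel, rule Lim_null_comparison)
  show "\<forall>\<^sub>F n in sequentially. norm (round_down n x - x) \<le> 1 / real (Suc n)"
    using round_down_diff by simp
  show "(\<lambda>n. 1 / real (Suc n)) \<longlonglongrightarrow> 0" using LIMSEQ_inverse_real_of_nat by (simp add: inverse_eq_divide)
qed

lemma finite_round_down_image: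
  assumes "\<And>\<omega>. \<omega> \<in> S \<Longrightarrow> \<bar>f \<omega>\<bar> \<le> A"
  shows "finite ((\<lambda>\<omega>. round_down n (f \<omega>)) ` S)"
proof (rule finite_subset)
  show "finite ((\<lambda>k. of_int k / real (Suc n)) ` {\<lfloor>- (real (Suc n) * A)\<rfloor>..\<lfloor>real (Suc n) * A\<rfloor>})" by simp
  show "(\<lambda>\<omega>. round_down n (f \<omega>)) ` S \<subseteq> (\<lambda>k. of_int k / real (Suc n)) ` {\<lfloor>- (real (Suc n) * A)\<rfloor>..\<lfloor>real (Suc n) * A\<rfloor>}"
  proof safe
    fix \<omega> assume "\<omega> \<in> S"
    then have "- A \<le> f \<omega>" "f \<omega> \<le> A" using assms[of \<omega>] by (auto simp: abs_le_iff)
    then have "real (Suc n) * (- A) \<le> real (Suc n) * f \<omega>" "real (Suc n) * f \<omega> \<le> real (Suc n) * A"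
      by (simp_all only: mult_left_mono of_nat_0_le_iff)
    then have "\<lfloor>- (real (Suc n) * A)\<rfloor> \<le> \<lfloor>real (Suc n) * f \<omega>\<rfloor>" "\<lfloor>real (Suc n) * f \<omega>\<rfloor> \<le> \<lfloor>real (Suc n) * A\<rfloor>"
      by (auto intro!: floor_mono)
    then show "round_down n (f \<omega>) \<in> (\<lambda>k. of_int k / real (Suc n)) ` {\<lfloor>- (real (Suc n) * A)\<rfloor>..\<lfloor>real (Suc n) * A\<rfloor>}"
      unfolding round_down_def by auto
  qed
qed

text \<open>Dominated convergence along ever finer grids. A + 1 replaces A because rounding moves a
  value by at most 1.\<close>

lemma (in prob_space) covariance_bounded:
  assumes sub: "subalgebra M F" "subalgebra M G"
    and dep: "dependence_bound M F G b"
    and f: "f \<in> borel_measurable F" "\<And>\<omega>. \<omega> \<in> space M \<Longrightarrow> \<bar>f \<omega>\<bar> \<le> A"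
    and g: "g \<in> borel_measurable G" "\<And>\<omega>. \<omega> \<in> space M \<Longrightarrow> \<bar>g \<omega>\<bar> \<le> A"
  shows "\<bar>expectation (\<lambda>\<omega>. f \<omega> * g \<omega>) - expectation f * expectation g\<bar> \<le> 2 * b * (A + 1)\<^sup>2"
proof -
  define f' where "f' = (\<lambda>n \<omega>. round_down n (f \<omega>))"
  define g' where "g' = (\<lambda>n \<omega>. round_down n (g \<omega>))"
  have rd[measurable]: "round_down n \<in> borel_measurable borel" for n
    unfolding round_down_def by measurable
  have mF: "h \<in> borel_measurable F \<Longrightarrow> h \<in> borel_measurable M" for h :: "'a \<Rightarrow> real"
    by (rule measurable_from_subalg[OF sub(1)])
  have mG: "h \<in> borel_measurable G \<Longrightarrow> h \<in> borel_measurable M" for h :: "'a \<Rightarrow> real"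
    by (rule measurable_from_subalg[OF sub(2)])
  have f'F: "f' n \<in> borel_measurable F" for n unfolding f'_def using f(1) by measurable
  have g'G: "g' n \<in> borel_measurable G" for n unfolding g'_def using g(1) by measurable
  note [measurable] = mF[OF f(1)] mG[OF g(1)] mF[OF f'F] mG[OF g'G]
  have bf: "\<bar>f' n \<omega>\<bar> \<le> A + 1" and bg: "\<bar>g' n \<omega>\<bar> \<le> A + 1" if "\<omega> \<in> space M" for n \<omega>
    unfolding f'_def g'_def using that f g by (auto intro!: round_down_bound)
  have lim: "(\<lambda>n. f' n \<omega>) \<longlonglongrightarrow> f \<omega>" "(\<lambda>n. g' n \<omega>) \<longlonglongrightarrow> g \<omega>" for \<omega>
    unfolding f'_def g'_def by (rule round_down_tendsto)+
  have 1: "(\<lambda>n. expectation (f' n)) \<longlonglongrightarrow> expectation f"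
    by (rule integral_dominated_convergence[where w = "\<lambda>_. A + 1"]) (use lim bf in auto)
  have 2: "(\<lambda>n. expectation (g' n)) \<longlonglongrightarrow> expectation g"
    by (rule integral_dominated_convergence[where w = "\<lambda>_. A + 1"]) (use lim bg in auto)
  have 3: "(\<lambda>n. expectation (\<lambda>\<omega>. f' n \<omega> * g' n \<omega>)) \<longlonglongrightarrow> expectation (\<lambda>\<omega>. f \<omega> * g \<omega>)"
  proof (rule integral_dominated_convergence[where w = "\<lambda>_. (A + 1) * (A + 1)"])
    show "AE \<omega> in M. (\<lambda>n. f' n \<omega> * g' n \<omega>) \<longlonglongrightarrow> f \<omega> * g \<omega>" using lim by (auto intro!: tendsto_mult)
    show "AE \<omega> in M. norm (f' n \<omega> * g' n \<omega>) \<le> (A + 1) * (A + 1)" for n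
    proof (rule AE_I2)
      fix \<omega> assume "\<omega> \<in> space M"
      from bf[OF this] bg[OF this] show "norm (f' n \<omega> * g' n \<omega>) \<le> (A + 1) * (A + 1)"
        unfolding real_norm_def abs_mult
        using order_trans[OF abs_ge_zero bf[OF \<open>\<omega> \<in> space M\<close>, of n]] by (intro mult_mono) auto
    qed
  qed measurable
  have "(\<lambda>n. \<bar>expectation (\<lambda>\<omega>. f' n \<omega> * g' n \<omega>) - expectation (f' n) * expectation (g' n)\<bar>)
    \<longlonglongrightarrow> \<bar>expectation (\<lambda>\<omega>. f \<omega> * g \<omega>) - expectation f * expectation g\<bar>"
    by (intro tendsto_intros 1 2 3)
  moreover have "\<bar>expectation (\<lambda>\<omega>. f' n \<omega> * g' n \<omega>) - expectation (f' n) * expectation (g' n)\<bar> \<le> 2 * b * (A + 1)\<^sup>2" for n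
    using f g by (intro covariance_simple_functions[OF sub dep] f'F g'G bf bg)
      (auto simp: f'_def g'_def intro!: finite_round_down_image)
  ultimately show ?thesis by (intro LIMSEQ_le_const2) auto
qed

section \<open>From bounded functions to finite fourth moments\<close>

lemma abs_le_one_plus_power4: "\<bar>x\<bar> \<le> 1 + (x::real) ^ 4"
proof (cases "\<bar>x\<bar> \<le> 1")
  case True
  moreover have "0 \<le> x ^ 4" by simp
  ultimately show ?thesis by linarith
next
  case False
  then have "\<bar>x\<bar> ^ 1 \<le> \<bar>x\<bar> ^ 4" by (intro power_increasing) auto
  then show ?thesis by simp
qed

lemma abs_cube_le_one_plus_power4: "\<bar>x\<bar> ^ 3 \<le> 1 + (x::real) ^ 4"
proof (cases "\<bar>x\<bar> \<le> 1")
  case True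
  then have "\<bar>x\<bar> ^ 3 \<le> 1" by (simp add: power_le_one)
  moreover have "0 \<le> x ^ 4" by simp
  ultimately show ?thesis by linarith
next
  case False
  then have "\<bar>x\<bar> ^ 3 \<le> \<bar>x\<bar> ^ 4" by (intro power_increasing) auto
  then show ?thesis by simp
qed

lemma abs_cube_mult_le: "\<bar>x\<bar> ^ 3 * \<bar>y\<bar> \<le> x ^ 4 + (y::real) ^ 4"
proof (cases "\<bar>x\<bar> \<le> \<bar>y\<bar>")
  case True
  then have "\<bar>x\<bar> ^ 3 * \<bar>y\<bar> \<le> \<bar>y\<bar> ^ 3 * \<bar>y\<bar>" by (intro mult_right_mono power_mono) auto
  also have "\<dots> = y ^ 4" by (simp add: power_Suc2[symmetric])
  finally show ?thesis by (rule order_trans) simp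
next
  case False
  then have "\<bar>x\<bar> ^ 3 * \<bar>y\<bar> \<le> \<bar>x\<bar> ^ 3 * \<bar>x\<bar>" by (intro mult_left_mono) auto
  also have "\<dots> = x ^ 4" by (simp add: power_Suc2[symmetric])
  finally show ?thesis by (rule order_trans) simp
qed

lemma abs_mult_le_power4: "\<bar>x * y\<bar> \<le> 1 + x ^ 4 + (y::real) ^ 4"
proof -
  have sq: "2 * z\<^sup>2 \<le> z ^ 4 + 1" for z :: real
    using zero_le_power2[of "z\<^sup>2 - 1"] by (simp add: power2_diff power_mult[symmetric])
  have "2 * \<bar>x * y\<bar> \<le> x\<^sup>2 + y\<^sup>2"
    using zero_le_power2[of "\<bar>x\<bar> - \<bar>y\<bar>"] by (simp add: power2_diff abs_mult)
  moreover have "0 \<le> x ^ 4" "0 \<le> y ^ 4" by simp_all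
  ultimately show ?thesis using sq[of x] sq[of y] by linarith
qed

text \<open>A covariance inequality of Davydov type. The truncated parts are bounded and fall under
  \<open>covariance_bounded\<close>; the cut-off parts satisfy |x - tr x| <= |x|^3 / A^2, so fourth
  moments control their covariances at order 1 / A^2.\<close>

lemma (in prob_space) covariance_truncation:
  assumes sub: "subalgebra M F" "subalgebra M G"
    and dep: "dependence_bound M F G b" and b: "0 < b" "b \<le> 2"
    and f: "f \<in> borel_measurable F" "integrable M (\<lambda>\<omega>. f \<omega> ^ 4)" "expectation (\<lambda>\<omega>. f \<omega> ^ 4) \<le> m"
    and g: "g \<in> borel_measurable G" "integrable M (\<lambda>\<omega>. g \<omega> ^ 4)" "expectation (\<lambda>\<omega>. g \<omega> ^ 4) \<le> m"
  shows "\<bar>expectation (\<lambda>\<omega>. f \<omega> * g \<omega>) - expectation f * expectation g\<bar>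
    \<le> (10 + 2 * (2 * m + (1 + m)\<^sup>2)) * sqrt b"
proof -
  \<comment> \<open>The truncation level balances the mixing term \<open>b A\<^sup>2\<close> against the tail term \<open>1 / A\<^sup>2\<close>.\<close>
  define A where "A = 1 / sqrt (sqrt b)"
  have A0: "A > 0" and A2: "A\<^sup>2 = 1 / sqrt b" using b by (simp_all add: A_def power_divide)
  define k where "k = 2 * m + (1 + m)\<^sup>2"
  have m0: "0 \<le> m" using f(3) by (rule order_trans[rotated]) (simp add: integral_nonneg_AE)
  define tr where "tr = (\<lambda>x::real. if \<bar>x\<bar> \<le> A then x else 0)"
  have [measurable]: "tr \<in> borel_measurable borel" unfolding tr_def by measurable
  have fF: "(\<lambda>\<omega>. tr (f \<omega>)) \<in> borel_measurable F" using f(1) by measurable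
  have gG: "(\<lambda>\<omega>. tr (g \<omega>)) \<in> borel_measurable G" using g(1) by measurable
  have tr: "\<bar>tr x\<bar> \<le> A" "\<bar>tr x\<bar> \<le> \<bar>x\<bar>" "\<bar>x - tr x\<bar> \<le> \<bar>x\<bar> ^ 3 / A\<^sup>2" "\<bar>x - tr x\<bar> \<le> \<bar>x\<bar>" for x
  proof -
    show "\<bar>x - tr x\<bar> \<le> \<bar>x\<bar> ^ 3 / A\<^sup>2"
    proof (cases "\<bar>x\<bar> \<le> A")
      case False
      then have "A\<^sup>2 \<le> \<bar>x\<bar>\<^sup>2" using A0 by (intro power_mono) auto
      then have "\<bar>x\<bar> * A\<^sup>2 \<le> \<bar>x\<bar> * \<bar>x\<bar>\<^sup>2" by (intro mult_left_mono) auto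
      then show ?thesis using False A0 by (simp add: tr_def field_simps power3_eq_cube power2_eq_square)
    qed (use A0 in \<open>simp add: tr_def\<close>)
  qed (use A0 in \<open>auto simp: tr_def\<close>)
  have prod_int: "integrable M (\<lambda>\<omega>. u \<omega> * v \<omega>)"
    if "u \<in> borel_measurable M" "v \<in> borel_measurable M" "integrable M (\<lambda>\<omega>. ub \<omega> ^ 4)" "integrable M (\<lambda>\<omega>. vb \<omega> ^ 4)"
      "\<And>\<omega>. \<bar>u \<omega>\<bar> \<le> \<bar>ub \<omega>\<bar>" "\<And>\<omega>. \<bar>v \<omega>\<bar> \<le> \<bar>vb \<omega>\<bar>" for u v ub vb :: "'a \<Rightarrow> real"
  proof (rule Bochner_Integration.integrable_bound)
    show "integrable M (\<lambda>\<omega>. 1 + ub \<omega> ^ 4 + vb \<omega> ^ 4)" using that by auto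
    have "\<bar>u \<omega> * v \<omega>\<bar> \<le> 1 + ub \<omega> ^ 4 + vb \<omega> ^ 4" for \<omega>
      using abs_mult_le_power4[of "ub \<omega>" "vb \<omega>"] mult_mono[OF that(5)[of \<omega>] that(6)[of \<omega>]]
      by (simp add: abs_mult)
    then show "AE \<omega> in M. norm (u \<omega> * v \<omega>) \<le> norm (1 + ub \<omega> ^ 4 + vb \<omega> ^ 4)"
      unfolding real_norm_def by (intro AE_I2 order_trans[OF _ abs_ge_self])
  qed (use that in measurable)
  have sing_int: "integrable M u"
    if "u \<in> borel_measurable M" "integrable M (\<lambda>\<omega>. ub \<omega> ^ 4)" "\<And>\<omega>. \<bar>u \<omega>\<bar> \<le> \<bar>ub \<omega>\<bar>" for u ub :: "'a \<Rightarrow> real"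
    using prod_int[of u "\<lambda>_. 1" ub "\<lambda>_. 1"] that by simp
  have E1: "\<bar>expectation u\<bar> \<le> 1 + m"
    if "u \<in> borel_measurable M" "integrable M (\<lambda>\<omega>. ub \<omega> ^ 4)" "\<And>\<omega>. \<bar>u \<omega>\<bar> \<le> \<bar>ub \<omega>\<bar>" "expectation (\<lambda>\<omega>. ub \<omega> ^ 4) \<le> m" for u ub
  proof -
    have "\<bar>expectation u\<bar> \<le> expectation (\<lambda>\<omega>. \<bar>u \<omega>\<bar>)" by (rule integral_abs_bound)
    also have "\<dots> \<le> expectation (\<lambda>\<omega>. 1 + ub \<omega> ^ 4)"
    proof (intro integral_mono)
      show "\<bar>u \<omega>\<bar> \<le> 1 + ub \<omega> ^ 4" for \<omega>
        using that(3)[of \<omega>] abs_le_one_plus_power4[of "ub \<omega>"] by linarith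
    qed (use sing_int[OF that(1,2,3)] that(2) in simp_all)
    also have "\<dots> = 1 + expectation (\<lambda>\<omega>. ub \<omega> ^ 4)" using that by (simp add: prob_space)
    finally show ?thesis using that by simp
  qed
  \<comment> \<open>The second factor need only be dominated by \<open>vb\<close>, since it is used
    once with g itself and once with the truncation of f.\<close>
  have rest: "\<bar>expectation (\<lambda>\<omega>. (u \<omega> - tr (u \<omega>)) * v \<omega>) - expectation (\<lambda>\<omega>. u \<omega> - tr (u \<omega>)) * expectation v\<bar> \<le> k / A\<^sup>2"
    if u: "u \<in> borel_measurable M" "integrable M (\<lambda>\<omega>. u \<omega> ^ 4)" "expectation (\<lambda>\<omega>. u \<omega> ^ 4) \<le> m"
      and v: "v \<in> borel_measurable M" "integrable M (\<lambda>\<omega>. vb \<omega> ^ 4)" "\<And>\<omega>. \<bar>v \<omega>\<bar> \<le> \<bar>vb \<omega>\<bar>" "expectation (\<lambda>\<omega>. vb \<omega> ^ 4) \<le> m" for u v vb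
  proof -
    note [measurable] = u(1) v(1)
    have i1: "integrable M (\<lambda>\<omega>. (u \<omega> - tr (u \<omega>)) * v \<omega>)" by (rule prod_int[OF _ _ u(2) v(2)], measurable, (rule tr(4) v(3))+)
    have i2: "integrable M (\<lambda>\<omega>. u \<omega> - tr (u \<omega>))" by (rule sing_int[OF _ u(2)], measurable, rule tr(4))
    have "\<bar>expectation (\<lambda>\<omega>. (u \<omega> - tr (u \<omega>)) * v \<omega>)\<bar> \<le> expectation (\<lambda>\<omega>. \<bar>(u \<omega> - tr (u \<omega>)) * v \<omega>\<bar>)"
      by (rule integral_abs_bound)
    also have "\<dots> \<le> expectation (\<lambda>\<omega>. (u \<omega> ^ 4 + vb \<omega> ^ 4) / A\<^sup>2)"
    proof (intro integral_mono)
      fix \<omega>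
      have "\<bar>(u \<omega> - tr (u \<omega>)) * v \<omega>\<bar> \<le> (\<bar>u \<omega>\<bar> ^ 3 / A\<^sup>2) * \<bar>vb \<omega>\<bar>"
        unfolding abs_mult using tr(3)[of "u \<omega>"] v(3)[of \<omega>] by (intro mult_mono) auto
      also have "\<dots> = (\<bar>u \<omega>\<bar> ^ 3 * \<bar>vb \<omega>\<bar>) / A\<^sup>2" by simp
      also have "\<dots> \<le> (u \<omega> ^ 4 + vb \<omega> ^ 4) / A\<^sup>2"
        by (intro divide_right_mono abs_cube_mult_le) simp
      finally show "\<bar>(u \<omega> - tr (u \<omega>)) * v \<omega>\<bar> \<le> (u \<omega> ^ 4 + vb \<omega> ^ 4) / A\<^sup>2" .
    qed (use i1 u(2) v(2) in simp_all)
    also have "\<dots> = (expectation (\<lambda>\<omega>. u \<omega> ^ 4) + expectation (\<lambda>\<omega>. vb \<omega> ^ 4)) / A\<^sup>2" using u v by simp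
    also have "\<dots> \<le> (2 * m) / A\<^sup>2" using u v by (intro divide_right_mono) auto
    finally have 1: "\<bar>expectation (\<lambda>\<omega>. (u \<omega> - tr (u \<omega>)) * v \<omega>)\<bar> \<le> (2 * m) / A\<^sup>2" .
    have "\<bar>expectation (\<lambda>\<omega>. u \<omega> - tr (u \<omega>))\<bar> \<le> expectation (\<lambda>\<omega>. \<bar>u \<omega> - tr (u \<omega>)\<bar>)"
      by (rule integral_abs_bound)
    also have "\<dots> \<le> expectation (\<lambda>\<omega>. (1 + u \<omega> ^ 4) / A\<^sup>2)"
    proof (intro integral_mono)
      fix \<omega>
      have "\<bar>u \<omega> - tr (u \<omega>)\<bar> \<le> \<bar>u \<omega>\<bar> ^ 3 / A\<^sup>2" by (rule tr)
      also have "\<dots> \<le> (1 + u \<omega> ^ 4) / A\<^sup>2"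
        by (intro divide_right_mono abs_cube_le_one_plus_power4) simp
      finally show "\<bar>u \<omega> - tr (u \<omega>)\<bar> \<le> (1 + u \<omega> ^ 4) / A\<^sup>2" .
    qed (use i2 u(2) in simp_all)
    also have "\<dots> = (1 + expectation (\<lambda>\<omega>. u \<omega> ^ 4)) / A\<^sup>2" using u by (simp add: prob_space)
    also have "\<dots> \<le> (1 + m) / A\<^sup>2" using u by (intro divide_right_mono) auto
    finally have 2: "\<bar>expectation (\<lambda>\<omega>. u \<omega> - tr (u \<omega>))\<bar> \<le> (1 + m) / A\<^sup>2" .
    have "\<bar>expectation (\<lambda>\<omega>. u \<omega> - tr (u \<omega>)) * expectation v\<bar> \<le> (1 + m) / A\<^sup>2 * (1 + m)"
      unfolding abs_mult using 2 E1[OF v] m0 by (intro mult_mono) auto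
    also have "\<dots> = (1 + m)\<^sup>2 / A\<^sup>2" by (simp add: power2_eq_square)
    finally show ?thesis using 1 unfolding k_def add_divide_distrib by linarith
  qed
  note [measurable] = measurable_from_subalg[OF sub(1) f(1)] measurable_from_subalg[OF sub(2) g(1)]
  have i: "integrable M f" "integrable M (\<lambda>\<omega>. tr (f \<omega>))"
    subgoal by (rule sing_int[OF _ f(2) order_refl]) measurable
    subgoal by (rule sing_int[OF _ f(2) tr(2)]) measurable
    done
  have i': "integrable M g" "integrable M (\<lambda>\<omega>. tr (g \<omega>))"
    subgoal by (rule sing_int[OF _ g(2) order_refl]) measurable
    subgoal by (rule sing_int[OF _ g(2) tr(2)]) measurable
    done
  have ip: "integrable M (\<lambda>\<omega>. tr (f \<omega>) * tr (g \<omega>))" "integrable M (\<lambda>\<omega>. f \<omega> * g \<omega>)" "integrable M (\<lambda>\<omega>. tr (f \<omega>) * g \<omega>)"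
    subgoal by (rule prod_int[OF _ _ f(2) g(2) tr(2) tr(2)]) measurable
    subgoal by (rule prod_int[OF _ _ f(2) g(2) order_refl order_refl]) measurable
    subgoal by (rule prod_int[OF _ _ f(2) g(2) tr(2) order_refl]) measurable
    done
  define c0 where "c0 = expectation (\<lambda>\<omega>. tr (f \<omega>) * tr (g \<omega>)) - expectation (\<lambda>\<omega>. tr (f \<omega>)) * expectation (\<lambda>\<omega>. tr (g \<omega>))"
  define c1 where "c1 = expectation (\<lambda>\<omega>. (f \<omega> - tr (f \<omega>)) * g \<omega>) - expectation (\<lambda>\<omega>. f \<omega> - tr (f \<omega>)) * expectation g"
  define c2 where "c2 = expectation (\<lambda>\<omega>. (g \<omega> - tr (g \<omega>)) * tr (f \<omega>)) - expectation (\<lambda>\<omega>. g \<omega> - tr (g \<omega>)) * expectation (\<lambda>\<omega>. tr (f \<omega>))"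
  have "\<bar>c1\<bar> \<le> k / A\<^sup>2" unfolding c1_def by (rule rest[OF _ f(2,3) _ g(2) order_refl g(3)]) measurable
  moreover have "\<bar>c2\<bar> \<le> k / A\<^sup>2" unfolding c2_def by (rule rest[OF _ g(2,3) _ f(2) tr(2) f(3)]) measurable
  moreover have "\<bar>c0\<bar> \<le> 2 * b * (A + 1)\<^sup>2" unfolding c0_def
    by (rule covariance_bounded[OF sub dep fF _ gG]) (use tr in simp_all)
  \<comment> \<open>Telescoping: f g = tr f tr g + (f - tr f) g + tr f (g - tr g), and likewise for
    the products of expectations.\<close>
  moreover have "expectation (\<lambda>\<omega>. f \<omega> * g \<omega>) - expectation f * expectation g = c0 + c1 + c2"
  proof -
    have "c1 = expectation (\<lambda>\<omega>. f \<omega> * g \<omega>) - expectation (\<lambda>\<omega>. tr (f \<omega>) * g \<omega>) - (expectation f - expectation (\<lambda>\<omega>. tr (f \<omega>))) * expectation g"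
      unfolding c1_def left_diff_distrib
      by (simp only: Bochner_Integration.integral_diff[OF ip(2,3)] Bochner_Integration.integral_diff[OF i] left_diff_distrib)
    moreover have "c2 = expectation (\<lambda>\<omega>. tr (f \<omega>) * g \<omega>) - expectation (\<lambda>\<omega>. tr (f \<omega>) * tr (g \<omega>)) - (expectation g - expectation (\<lambda>\<omega>. tr (g \<omega>))) * expectation (\<lambda>\<omega>. tr (f \<omega>))"
      unfolding c2_def left_diff_distrib mult.commute[of "g _"] mult.commute[of "tr (g _)"]
      by (simp only: Bochner_Integration.integral_diff[OF ip(3,1)] Bochner_Integration.integral_diff[OF i'] left_diff_distrib)
    ultimately show ?thesis unfolding c0_def left_diff_distrib
      mult.commute[of "expectation g"] mult.commute[of "expectation (\<lambda>\<omega>. tr (g \<omega>))"] by linarith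
  qed
  ultimately have "\<bar>expectation (\<lambda>\<omega>. f \<omega> * g \<omega>) - expectation f * expectation g\<bar> \<le> 2 * b * (A + 1)\<^sup>2 + 2 * (k / A\<^sup>2)"
    by linarith
  also have "k / A\<^sup>2 = k * sqrt b" using A2 by simp
  \<comment> \<open>With A^2 = 1 / sqrt b and (A + 1)^2 <= 2 A^2 + 2 the left side is at most 4 sqrt
    b + 4 b. Since b <= 2 gives sqrt b <= 3/2, the second summand is at most 6 sqrt b.\<close>
  also have "2 * b * (A + 1)\<^sup>2 \<le> 10 * sqrt b"
  proof -
    have "0 \<le> (A - 1)\<^sup>2" by simp
    then have "(A + 1)\<^sup>2 \<le> 2 * A\<^sup>2 + 2" by (simp add: power2_eq_square algebra_simps)
    then have "2 * b * (A + 1)\<^sup>2 \<le> 2 * b * (2 * A\<^sup>2 + 2)" using b by (intro mult_left_mono) auto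
    also have "\<dots> = 4 * (b / sqrt b) + 4 * b" using A2 by (simp add: algebra_simps)
    also have "\<dots> = 4 * sqrt b + 4 * (sqrt b * sqrt b)" using b by (simp add: real_div_sqrt)
    also have "\<dots> \<le> 4 * sqrt b + 4 * (3 / 2 * sqrt b)"
    proof -
      have "sqrt b \<le> 3 / 2" using b by (intro real_le_lsqrt) (auto simp: power2_eq_square)
      then show ?thesis using b by (intro add_left_mono mult_left_mono mult_right_mono) auto
    qed
    finally show ?thesis by simp
  qed
  finally show ?thesis unfolding k_def by (simp add: algebra_simps)
qed

section \<open>Sampling error of the covariance matrix\<close>

lemma space_vec_borel [simp]: "space (vec_borel p) = carrier_vec p"
  by (simp add: vec_borel_def)

lemma measurable_vec_index [measurable]:
  assumes "i < p"
  shows "(\<lambda>v. v $ i) \<in> borel_measurable (vec_borel p)"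
proof -
  have "(\<lambda>v. \<lambda>j\<in>{..<p}. v $ j) \<in> measurable (vec_borel p) (\<Pi>\<^sub>M j\<in>{..<p}. borel :: real measure)"
    unfolding vec_borel_def by (rule measurable_vimage_algebra1) (auto simp: space_PiM)
  from measurable_compose[OF this measurable_component_singleton[of i]] assms
  show ?thesis by (simp add: restrict_def)
qed

lemma measurable_vec_component:
  assumes "Y \<in> measurable N (vec_borel p)" "i < p"
  shows "(\<lambda>\<omega>. Y \<omega> $ i) \<in> borel_measurable N"
  using measurable_compose[OF assms(1) measurable_vec_index[OF assms(2)]] .

text \<open>\<open>generated_events\<close> packaged as a measure, so that measurability with
  respect to past or future can be expressed.\<close>

definition window_algebra :: "'a measure \<Rightarrow> nat \<Rightarrow> (int \<Rightarrow> 'a \<Rightarrow> real vec) \<Rightarrow> int set \<Rightarrow> 'a measure" where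
  "window_algebra M p X T =
     sigma (space M) (\<Union>t\<in>T. {X t -` B \<inter> space M |B. B \<in> sets (vec_borel p)})"

lemma space_window_algebra [simp]: "space (window_algebra M p X T) = space M"
  unfolding window_algebra_def by (rule space_measure_of) auto

lemma sets_window_algebra: "sets (window_algebra M p X T) = generated_events M p X T"
  unfolding window_algebra_def generated_events_def by (rule sets_measure_of) auto

lemma subalgebra_window:
  assumes "time_series M p X"
  shows "subalgebra M (window_algebra M p X T)"
proof -
  have "sigma_sets (space M) (\<Union>t\<in>T. {X t -` B \<inter> space M |B. B \<in> sets (vec_borel p)}) \<subseteq> sets M"
    by (rule sets.sigma_sets_subset) (use assms in \<open>auto simp: time_series_def intro: measurable_sets\<close>)
  then show ?thesis by (simp add: subalgebra_def sets_window_algebra generated_events_def)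
qed

lemma measurable_window:
  assumes "time_series M p X" "t \<in> T"
  shows "X t \<in> measurable (window_algebra M p X T) (vec_borel p)"
proof (rule measurableI)
  fix \<omega> assume "\<omega> \<in> space (window_algebra M p X T)"
  then show "X t \<omega> \<in> space (vec_borel p)"
    using assms(1) measurable_space[of "X t" M "vec_borel p" \<omega>] by (simp add: time_series_def)
next
  fix B assume "B \<in> sets (vec_borel p)"
  then show "X t -` B \<inter> space (window_algebra M p X T) \<in> sets (window_algebra M p X T)"
    unfolding sets_window_algebra generated_events_def space_window_algebra
    using assms(2) by (intro sigma_sets.Basic) blast
qed

section \<open>Mixing coefficients as dependence bounds\<close>

lemma (in prob_space) sum_prob_partition:
  assumes "finite \<A>" "partition_on (space M) \<A>" "\<A> \<subseteq> events"
  shows "(\<Sum>A\<in>\<A>. prob A) = 1"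
proof -
  have "prob (\<Union>A\<in>\<A>. A) = (\<Sum>A\<in>\<A>. prob A)"
    using assms by (intro finite_measure_finite_Union)
      (auto simp: partition_on_def disjoint_family_on_def disjoint_def)
  moreover have "(\<Union>A\<in>\<A>. A) = space M" using assms(2) by (auto simp: partition_on_def)
  ultimately show ?thesis by (simp add: prob_space)
qed

lemma (in prob_space) sum_prob_Int_partition:
  assumes "finite \<A>" "partition_on (space M) \<A>" "\<A> \<subseteq> events" "B \<in> events"
  shows "(\<Sum>A\<in>\<A>. prob (B \<inter> A)) = prob B"
proof -
  have "prob (\<Union>A\<in>\<A>. B \<inter> A) = (\<Sum>A\<in>\<A>. prob (B \<inter> A))"
  proof (rule finite_measure_finite_Union)
    show "disjoint_family_on (\<lambda>A. B \<inter> A) \<A>"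
      using assms(2) by (auto simp: partition_on_def disjoint_family_on_def disjoint_def)
    show "(\<lambda>A. B \<inter> A) ` \<A> \<subseteq> events" using assms(3,4) by auto
  qed fact
  moreover have "(\<Union>A\<in>\<A>. B \<inter> A) = B"
    using assms(2) sets.sets_into_space[OF assms(4)] by (auto simp: partition_on_def)
  ultimately show ?thesis by simp
qed

text \<open>Makes the set behind \<open>beta_mixing_coeff\<close> bounded above, so that each of its
  elements lies below its \<open>Sup\<close>. The bound holds because the joint and the product
  probabilities each sum to 1.\<close>

lemma (in prob_space) partition_dependence_le_1:
  assumes \<A>: "finite \<A>" "partition_on (space M) \<A>" "\<A> \<subseteq> events"
    and \<B>: "finite \<B>" "partition_on (space M) \<B>" "\<B> \<subseteq> events"
  shows "1 / 2 * (\<Sum>A\<in>\<A>. \<Sum>B\<in>\<B>. \<bar>prob (A \<inter> B) - prob A * prob B\<bar>) \<le> 1"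
proof -
  have "(\<Sum>A\<in>\<A>. \<Sum>B\<in>\<B>. \<bar>prob (A \<inter> B) - prob A * prob B\<bar>)
      \<le> (\<Sum>A\<in>\<A>. \<Sum>B\<in>\<B>. prob (A \<inter> B) + prob A * prob B)"
  proof (rule sum_mono, rule sum_mono)
    fix A B
    have "0 \<le> prob (A \<inter> B)" "0 \<le> prob A * prob B" by simp_all
    then show "\<bar>prob (A \<inter> B) - prob A * prob B\<bar> \<le> prob (A \<inter> B) + prob A * prob B" by linarith
  qed
  also have "\<dots> = (\<Sum>A\<in>\<A>. prob A + prob A * 1)"
  proof (rule sum.cong[OF refl])
    fix A assume "A \<in> \<A>"
    then have "A \<in> events" using \<A>(3) by auto
    then show "(\<Sum>B\<in>\<B>. prob (A \<inter> B) + prob A * prob B) = prob A + prob A * 1"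
      by (simp only: sum.distrib sum_distrib_left[symmetric] sum_prob_partition[OF \<B>]
          sum_prob_Int_partition[OF \<B>])
  qed
  also have "\<dots> = 2" by (simp only: mult_1_right sum.distrib sum_prob_partition[OF \<A>])
  finally show ?thesis by simp
qed

text \<open>The supremum also runs over the time t, so a single bound on the coefficient serves
  every split into past and future.\<close>

lemma dependence_bound_beta_mixing:
  assumes ts: "time_series M p X" and b: "beta_mixing_coeff M p X l \<le> b"
  shows "dependence_bound M (window_algebra M p X {..t}) (window_algebra M p X {t + int l..}) b"
  unfolding dependence_bound_def
proof (intro allI impI)
  interpret prob_space M using ts by (simp add: time_series_def)
  have sub: "generated_events M p X T \<subseteq> events" for T
    using subalgebra_window[OF ts, of T] by (simp add: subalgebra_def sets_window_algebra)
  fix \<A> \<B>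
  assume AB: "finite \<A> \<and> partition_on (space M) \<A> \<and> \<A> \<subseteq> sets (window_algebra M p X {..t}) \<and>
    finite \<B> \<and> partition_on (space M) \<B> \<and> \<B> \<subseteq> sets (window_algebra M p X {t + int l..})"
  let ?D = "{1 / 2 * (\<Sum>A\<in>\<A>. \<Sum>B\<in>\<B>. \<bar>measure M (A \<inter> B) - measure M A * measure M B\<bar>) |\<A> \<B> t.
        finite \<A> \<and> partition_on (space M) \<A> \<and> \<A> \<subseteq> generated_events M p X {..t} \<and>
        finite \<B> \<and> partition_on (space M) \<B> \<and> \<B> \<subseteq> generated_events M p X {t + int l..}}"
  have "1 / 2 * (\<Sum>A\<in>\<A>. \<Sum>B\<in>\<B>. \<bar>prob (A \<inter> B) - prob A * prob B\<bar>) \<le> Sup ?D"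
  proof (rule cSup_upper)
    show "1 / 2 * (\<Sum>A\<in>\<A>. \<Sum>B\<in>\<B>. \<bar>prob (A \<inter> B) - prob A * prob B\<bar>) \<in> ?D"
      using AB unfolding sets_window_algebra by blast
    show "bdd_above ?D"
    proof (rule bdd_aboveI)
      fix x assume "x \<in> ?D"
      then obtain \<A>' \<B>' t' where x: "x = 1 / 2 * (\<Sum>A\<in>\<A>'. \<Sum>B\<in>\<B>'. \<bar>prob (A \<inter> B) - prob A * prob B\<bar>)"
        and *: "finite \<A>'" "partition_on (space M) \<A>'" "\<A>' \<subseteq> generated_events M p X {..t'}"
          "finite \<B>'" "partition_on (space M) \<B>'" "\<B>' \<subseteq> generated_events M p X {t' + int l..}"
        by blast
      show "x \<le> 1" unfolding x
        by (rule partition_dependence_le_1[OF *(1,2) order_trans[OF *(3) sub] *(4,5) order_trans[OF *(6) sub]])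
    qed
  qed
  then show "1 / 2 * (\<Sum>A\<in>\<A>. \<Sum>B\<in>\<B>. \<bar>prob (A \<inter> B) - prob A * prob B\<bar>) \<le> b"
    using b unfolding beta_mixing_coeff_def by linarith
qed

section \<open>Moments of products of coordinates\<close>

lemma stationary_product_expectation:
  assumes ts: "time_series M p X" and st: "strictly_stationary M p X" and ij: "i < p" "j < p"
  shows "(\<integral>\<omega>. X t \<omega> $ i * X t \<omega> $ j \<partial>M) = (\<integral>\<omega>. X 0 \<omega> $ i * X 0 \<omega> $ j \<partial>M)"
proof -
  let ?N = "\<Pi>\<^sub>M s\<in>{0::int}. vec_borel p"
  define g where "g = (\<lambda>h :: int \<Rightarrow> real vec. h 0 $ i * h 0 $ j)"
  have c: "(\<lambda>h. h 0) \<in> measurable ?N (vec_borel p)" by (rule measurable_component_singleton) simp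
  have g: "g \<in> borel_measurable ?N" unfolding g_def
    by (intro borel_measurable_times measurable_vec_component[OF c] ij)
  have X: "(\<lambda>\<omega>. \<lambda>s\<in>{0}. X (s + h) \<omega>) \<in> measurable M ?N" for h
    by (rule measurable_restrict) (use ts in \<open>simp add: time_series_def\<close>)
  have "integral\<^sup>L (distr M ?N (\<lambda>\<omega>. \<lambda>s\<in>{0}. X (s + t) \<omega>)) g = integral\<^sup>L (distr M ?N (\<lambda>\<omega>. \<lambda>s\<in>{0}. X s \<omega>)) g"
    using st[unfolded strictly_stationary_def, rule_format, of "{0}" t] by simp
  then show ?thesis
    using integral_distr[OF X[of t] g] integral_distr[OF X[of 0] g] by (simp add: g_def)
qed

text \<open>Evaluates the vector norm at the unit vector e_i and at q = 8. Integrability comes from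
  the sub-Weibull property of the coordinate, as the norm bound alone would also admit the default
  integral 0.\<close>

lemma eighth_moment_bound:
  assumes ts: "time_series M p X" and i: "i < p" and \<gamma>2: "\<gamma>2 > 0"
    and sw: "sub_weibull_vec M p \<gamma>2 (X t)" and psi: "psi_norm_vec M p \<gamma>2 (X t) \<le> ereal K"
  shows "integrable M (\<lambda>\<omega>. (X t \<omega> $ i) ^ 8)"
    and "(\<integral>\<omega>. (X t \<omega> $ i) ^ 8 \<partial>M) \<le> (K * 8 powr (1 / \<gamma>2)) ^ 8"
proof -
  have pw: "\<bar>x\<bar> powr 8 = x ^ 8" for x :: real by simp
  obtain K' where K': "\<forall>q\<ge>min 1 \<gamma>2. integrable M (\<lambda>\<omega>. \<bar>X t \<omega> $ i\<bar> powr q) \<and>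
        (\<integral>\<omega>. \<bar>X t \<omega> $ i\<bar> powr q \<partial>M) powr (1 / q) \<le> K' * q powr (1 / \<gamma>2)"
    using sw i unfolding sub_weibull_vec_def sub_weibull_def by blast
  then show "integrable M (\<lambda>\<omega>. (X t \<omega> $ i) ^ 8)" using pw by (auto dest: spec[of _ 8])
  define I where "I = (\<integral>\<omega>. (X t \<omega> $ i) ^ 8 \<partial>M)"
  have I0: "0 \<le> I" unfolding I_def by simp
  let ?e = "unit_vec p i :: real vec"
  have "l2_norm ?e = 1"
  proof -
    have "(\<Sum>j<p. (?e $ j)\<^sup>2) = (\<Sum>j<p. if j = i then 1 else 0)"
      by (intro sum.cong) (auto simp: unit_vec_def)
    then show ?thesis using i by (simp add: l2_norm_def)
  qed
  then have "psi_norm M \<gamma>2 (\<lambda>\<omega>. ?e \<bullet> X t \<omega>) \<le> psi_norm_vec M p \<gamma>2 (X t)"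
    unfolding psi_norm_vec_def by (intro SUP_upper) simp
  moreover have "ereal ((\<integral>\<omega>. \<bar>?e \<bullet> X t \<omega>\<bar> powr 8 \<partial>M) powr (1 / 8) * 8 powr (- 1 / \<gamma>2)) \<le> psi_norm M \<gamma>2 (\<lambda>\<omega>. ?e \<bullet> X t \<omega>)"
    unfolding psi_norm_def by (intro SUP_upper) simp
  moreover have "(\<integral>\<omega>. \<bar>?e \<bullet> X t \<omega>\<bar> powr 8 \<partial>M) = I"
    unfolding I_def
  proof (rule Bochner_Integration.integral_cong[OF refl])
    fix \<omega> assume "\<omega> \<in> space M"
    then have "X t \<omega> \<in> carrier_vec p"
      using ts measurable_space[of "X t" M "vec_borel p" \<omega>] by (simp add: time_series_def)
    then show "\<bar>?e \<bullet> X t \<omega>\<bar> powr 8 = (X t \<omega> $ i) ^ 8"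
      using i pw by simp
  qed
  ultimately have "ereal (I powr (1 / 8) * 8 powr (- 1 / \<gamma>2)) \<le> ereal K"
    using psi by (metis order_trans)
  then have "I powr (1 / 8) * 8 powr (- 1 / \<gamma>2) \<le> K" by simp
  then have "I powr (1 / 8) * 8 powr (- 1 / \<gamma>2) * 8 powr (1 / \<gamma>2) \<le> K * 8 powr (1 / \<gamma>2)"
    by (rule mult_right_mono) simp
  moreover have "8 powr (- 1 / \<gamma>2) * 8 powr (1 / \<gamma>2) = (1 :: real)"
    by (subst powr_add[symmetric]) simp
  ultimately have "I powr (1 / 8) \<le> K * 8 powr (1 / \<gamma>2)" by (simp only: mult.assoc mult_1_right)
  then have "(I powr (1 / 8)) ^ 8 \<le> (K * 8 powr (1 / \<gamma>2)) ^ 8" by (rule power_mono) simp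
  moreover have "(I powr (1 / 8)) ^ 8 = I"
  proof -
    have "(I powr (1 / 8)) ^ 8 = (I powr (1 / 8)) powr 8" by simp
    then show ?thesis using I0 by (simp add: powr_powr)
  qed
  ultimately show "(\<integral>\<omega>. (X t \<omega> $ i) ^ 8 \<partial>M) \<le> (K * 8 powr (1 / \<gamma>2)) ^ 8"
    unfolding I_def by simp
qed

lemma power4_mult_le: "(x * y) ^ 4 \<le> x ^ 8 + (y::real) ^ 8"
proof -
  have "2 * (x ^ 4 * y ^ 4) \<le> x ^ 8 + y ^ 8"
    using zero_le_power2[of "x ^ 4 - y ^ 4"] by (simp add: power2_diff power_mult[symmetric])
  moreover have "0 \<le> x ^ 4 * y ^ 4" by simp
  ultimately show ?thesis by (simp only: power_mult_distrib)
qed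

lemma product_fourth_moment_bound:
  assumes ts: "time_series M p X" and ij: "i < p" "j < p" and \<gamma>2: "\<gamma>2 > 0"
    and sw: "sub_weibull_vec M p \<gamma>2 (X t)" and psi: "psi_norm_vec M p \<gamma>2 (X t) \<le> ereal K"
  shows "integrable M (\<lambda>\<omega>. (X t \<omega> $ i * X t \<omega> $ j) ^ 4)"
    and "(\<integral>\<omega>. (X t \<omega> $ i * X t \<omega> $ j) ^ 4 \<partial>M) \<le> 2 * (K * 8 powr (1 / \<gamma>2)) ^ 8"
proof -
  have Xt: "X t \<in> measurable M (vec_borel p)" using ts by (simp add: time_series_def)
  note [measurable] = measurable_vec_component[OF Xt ij(1)] measurable_vec_component[OF Xt ij(2)]
  note mi = eighth_moment_bound[OF ts ij(1) \<gamma>2 sw psi] and mj = eighth_moment_bound[OF ts ij(2) \<gamma>2 sw psi]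
  show int: "integrable M (\<lambda>\<omega>. (X t \<omega> $ i * X t \<omega> $ j) ^ 4)"
  proof (rule Bochner_Integration.integrable_bound[OF Bochner_Integration.integrable_add[OF mi(1) mj(1)]])
    show "AE \<omega> in M. norm ((X t \<omega> $ i * X t \<omega> $ j) ^ 4) \<le> norm ((X t \<omega> $ i) ^ 8 + (X t \<omega> $ j) ^ 8)"
      using power4_mult_le by (intro AE_I2) (simp add: power4_mult_le)
  qed measurable
  have "(\<integral>\<omega>. (X t \<omega> $ i * X t \<omega> $ j) ^ 4 \<partial>M) \<le> (\<integral>\<omega>. (X t \<omega> $ i) ^ 8 + (X t \<omega> $ j) ^ 8 \<partial>M)"
    by (rule integral_mono[OF int Bochner_Integration.integrable_add[OF mi(1) mj(1)]]) (rule power4_mult_le)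
  also have "\<dots> = (\<integral>\<omega>. (X t \<omega> $ i) ^ 8 \<partial>M) + (\<integral>\<omega>. (X t \<omega> $ j) ^ 8 \<partial>M)"
    by (rule Bochner_Integration.integral_add[OF mi(1) mj(1)])
  finally show "(\<integral>\<omega>. (X t \<omega> $ i * X t \<omega> $ j) ^ 4 \<partial>M) \<le> 2 * (K * 8 powr (1 / \<gamma>2)) ^ 8"
    using mi(2) mj(2) by linarith
qed

section \<open>Mean square error of time averages\<close>

text \<open>Every lag occurs at most once before s and at most once from s on, hence the factor
  2.\<close>

lemma sum_abs_diff_le_suminf:
  fixes a :: "nat \<Rightarrow> real"
  assumes a: "summable a" "\<And>l. 0 \<le> a l" and s: "s \<in> {1..n}"
  shows "(\<Sum>t=1..n. a (nat \<bar>int t - int s\<bar>)) \<le> 2 * suminf a"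
proof -
  let ?f = "\<lambda>t. nat \<bar>int t - int s\<bar>"
  have part: "(\<Sum>t\<in>T. a (?f t)) \<le> suminf a" if "finite T" "inj_on ?f T" for T
    using sum_le_suminf[OF a(1), of "?f ` T"] a(2) that by (simp add: sum.reindex)
  have "{1..n} = {1..<s} \<union> {s..n}" using s by auto
  moreover have "{1..<s} \<inter> {s..n} = {}" by auto
  ultimately have "(\<Sum>t=1..n. a (?f t)) = (\<Sum>t\<in>{1..<s}. a (?f t)) + (\<Sum>t\<in>{s..n}. a (?f t))"
    by (metis sum.union_disjoint finite_atLeastLessThan finite_atLeastAtMost)
  also have "\<dots> \<le> suminf a + suminf a"
    by (intro add_mono part) (auto simp: inj_on_def)
  finally show ?thesis by simp
qed

text \<open>The square expands into n^2 covariances. Each of the n rows sums to at most 2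
  \<open>suminf a\<close>, so division by n^2 leaves order 1 / n. Covariance bounds for s <= t
  suffice, by symmetry of the product.\<close>

lemma (in prob_space) mean_square_error_le:
  fixes Z :: "nat \<Rightarrow> 'a \<Rightarrow> real" and a :: "nat \<Rightarrow> real"
  assumes n: "n > 0"
    and Z: "\<And>t. integrable M (Z t)" "\<And>t. expectation (Z t) = \<mu>"
    and ZZ: "\<And>s t. integrable M (\<lambda>\<omega>. Z s \<omega> * Z t \<omega>)"
    and cov: "\<And>s t. s \<le> t \<Longrightarrow> \<bar>expectation (\<lambda>\<omega>. Z s \<omega> * Z t \<omega>) - \<mu> * \<mu>\<bar> \<le> a (t - s)"
    and a: "summable a" "\<And>l. 0 \<le> a l"
  shows "integrable M (\<lambda>\<omega>. ((1 / real n) * (\<Sum>t=1..n. Z t \<omega>) - \<mu>)\<^sup>2)"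
    and "expectation (\<lambda>\<omega>. ((1 / real n) * (\<Sum>t=1..n. Z t \<omega>) - \<mu>)\<^sup>2) \<le> 2 * suminf a / real n"
proof -
  have eq: "((1 / real n) * (\<Sum>t=1..n. Z t \<omega>) - \<mu>)\<^sup>2
      = (1 / (real n)\<^sup>2) * (\<Sum>s=1..n. \<Sum>t=1..n. (Z s \<omega> - \<mu>) * (Z t \<omega> - \<mu>))" for \<omega>
  proof -
    have "(1 / real n) * (\<Sum>t=1..n. Z t \<omega>) - \<mu> = (1 / real n) * (\<Sum>t=1..n. Z t \<omega> - \<mu>)"
      using n by (simp add: sum_subtractf field_simps)
    then show ?thesis by (simp add: power_mult_distrib power_divide power2_eq_square[of "sum _ _"] sum_product)
  qed
  have ex: "(Z s \<omega> - \<mu>) * (Z t \<omega> - \<mu>) = Z s \<omega> * Z t \<omega> - \<mu> * Z s \<omega> - \<mu> * Z t \<omega> + \<mu> * \<mu>" for s t \<omega>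
    by (simp add: algebra_simps)
  have i: "integrable M (\<lambda>\<omega>. (Z s \<omega> - \<mu>) * (Z t \<omega> - \<mu>))" for s t
    unfolding ex by (intro Bochner_Integration.integrable_add Bochner_Integration.integrable_diff ZZ
      integrable_mult_right Z(1) integrable_const)
  have E: "expectation (\<lambda>\<omega>. (Z s \<omega> - \<mu>) * (Z t \<omega> - \<mu>)) = expectation (\<lambda>\<omega>. Z s \<omega> * Z t \<omega>) - \<mu> * \<mu>" for s t
    unfolding ex using ZZ[of s t] Z(1)[of s] Z(1)[of t] Z(2)[of s] Z(2)[of t] by (simp add: prob_space)
  have bound: "expectation (\<lambda>\<omega>. (Z s \<omega> - \<mu>) * (Z t \<omega> - \<mu>)) \<le> a (nat \<bar>int t - int s\<bar>)" for s t
  proof (cases "s \<le> t")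
    case True
    then have "nat \<bar>int t - int s\<bar> = t - s" by auto
    then show ?thesis using abs_le_D1[OF cov[OF True]] unfolding E by presburger
  next
    case False
    then have "nat \<bar>int t - int s\<bar> = s - t" by auto
    then show ?thesis using cov[of t s] E[of t s] False by (simp add: mult.commute)
  qed
  show "integrable M (\<lambda>\<omega>. ((1 / real n) * (\<Sum>t=1..n. Z t \<omega>) - \<mu>)\<^sup>2)"
    unfolding eq by (intro integrable_mult_right Bochner_Integration.integrable_sum i)
  have "expectation (\<lambda>\<omega>. ((1 / real n) * (\<Sum>t=1..n. Z t \<omega>) - \<mu>)\<^sup>2)
      = (1 / (real n)\<^sup>2) * (\<Sum>s=1..n. \<Sum>t=1..n. expectation (\<lambda>\<omega>. (Z s \<omega> - \<mu>) * (Z t \<omega> - \<mu>)))"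
    unfolding eq by (simp only: integral_mult_right_zero Bochner_Integration.integral_sum
        Bochner_Integration.integrable_sum i)
  also have "\<dots> \<le> (1 / (real n)\<^sup>2) * (\<Sum>s=1..n. 2 * suminf a)"
  proof (intro mult_left_mono sum_mono)
    fix s assume "s \<in> {1..n}"
    have "(\<Sum>t=1..n. expectation (\<lambda>\<omega>. (Z s \<omega> - \<mu>) * (Z t \<omega> - \<mu>))) \<le> (\<Sum>t=1..n. a (nat \<bar>int t - int s\<bar>))"
      by (intro sum_mono bound)
    also have "\<dots> \<le> 2 * suminf a" by (rule sum_abs_diff_le_suminf[OF a]) fact
    finally show "(\<Sum>t=1..n. expectation (\<lambda>\<omega>. (Z s \<omega> - \<mu>) * (Z t \<omega> - \<mu>))) \<le> 2 * suminf a" .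
  qed simp
  also have "\<dots> = 2 * suminf a / real n" using n by (simp add: power2_eq_square)
  finally show "expectation (\<lambda>\<omega>. ((1 / real n) * (\<Sum>t=1..n. Z t \<omega>) - \<mu>)\<^sup>2) \<le> 2 * suminf a / real n" .
qed

text \<open>The square root comes from \<open>covariance_truncation\<close>; for every \<gamma> > 0
  the decay still beats l^-2.\<close>

lemma summable_stretched_exp:
  fixes c \<gamma> :: real
  assumes "c > 0" "\<gamma> > 0"
  shows "summable (\<lambda>l. sqrt (2 * exp (- c * real l powr \<gamma>)))"
proof (rule summable_comparison_test_bigo)
  show "summable (\<lambda>l. norm (1 / real l ^ 2))"
    using inverse_power_summable[of 2, where 'a=real] by (simp add: inverse_eq_divide norm_divide norm_power)
  show "(\<lambda>l. sqrt (2 * exp (- c * real l powr \<gamma>))) \<in> O(\<lambda>l. 1 / real l ^ 2)"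
    using assms by real_asymp
qed

text \<open>The right-hand side of \<open>covariance_truncation\<close>, with m bounding the fourth
  moments of products of coordinates and b the mixing bound at lag l.\<close>

definition covariance_bound :: "real \<Rightarrow> real \<Rightarrow> real \<Rightarrow> real \<Rightarrow> nat \<Rightarrow> real" where
  "covariance_bound c \<gamma>1 \<gamma>2 K l =
     (let m = 2 * (K * 8 powr (1 / \<gamma>2)) ^ 8
      in (10 + 2 * (2 * m + (1 + m)\<^sup>2)) * sqrt (2 * exp (- c * real l powr \<gamma>1)))"

lemma covariance_bound_nonneg: "0 \<le> covariance_bound c \<gamma>1 \<gamma>2 K l"
  unfolding covariance_bound_def Let_def
  by (intro mult_nonneg_nonneg add_nonneg_nonneg) (auto simp: zero_le_even_power)

lemma summable_covariance_bound:
  "c > 0 \<Longrightarrow> \<gamma>1 > 0 \<Longrightarrow> summable (covariance_bound c \<gamma>1 \<gamma>2 K)"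
  unfolding covariance_bound_def Let_def by (intro summable_mult summable_stretched_exp)

lemma product_covariance_le:
  assumes ts: "time_series M p X" and st: "strictly_stationary M p X"
    and mix: "\<And>l. beta_mixing_coeff M p X l \<le> 2 * exp (- c * real l powr \<gamma>1)" and c: "c > 0" "\<gamma>1 > 0"
    and \<gamma>2: "\<gamma>2 > 0"
    and sw: "\<And>t. sub_weibull_vec M p \<gamma>2 (X t)" and psi: "\<And>t. psi_norm_vec M p \<gamma>2 (X t) \<le> ereal K"
    and ij: "i < p" "j < p" and le: "s \<le> (t :: nat)"
  shows "\<bar>(\<integral>\<omega>. (X (int s) \<omega> $ i * X (int s) \<omega> $ j) * (X (int t) \<omega> $ i * X (int t) \<omega> $ j) \<partial>M)
     - pop_cov M p X $$ (i, j) * pop_cov M p X $$ (i, j)\<bar> \<le> covariance_bound c \<gamma>1 \<gamma>2 K (t - s)"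
proof -
  interpret prob_space M using ts by (simp add: time_series_def)
  \<comment> \<open>\<open>int s + int (t - s)\<close> is \<open>int t\<close> in the form that
    exhibits the lag t - s.\<close>
  let ?F = "window_algebra M p X {..int s}" and ?G = "window_algebra M p X {int s + int (t - s)..}"
  have F: "X (int s) \<in> measurable ?F (vec_borel p)" by (rule measurable_window[OF ts]) simp
  have G: "X (int t) \<in> measurable ?G (vec_borel p)" using le by (intro measurable_window[OF ts]) simp
  note m = product_fourth_moment_bound[OF ts ij \<gamma>2 sw psi]
  have E: "expectation (\<lambda>\<omega>. X r \<omega> $ i * X r \<omega> $ j) = pop_cov M p X $$ (i, j)" for r
    using stationary_product_expectation[OF ts st ij, of r] ij by (simp add: pop_cov_def)
  \<comment> \<open>Supplies the premise b <= 2 of the covariance inequality, at lag 0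
    included.\<close>
  have "2 * exp (- c * real (t - s) powr \<gamma>1) \<le> 2" using c by simp
  then have "\<bar>expectation (\<lambda>\<omega>. (X (int s) \<omega> $ i * X (int s) \<omega> $ j) * (X (int t) \<omega> $ i * X (int t) \<omega> $ j))
      - expectation (\<lambda>\<omega>. X (int s) \<omega> $ i * X (int s) \<omega> $ j) * expectation (\<lambda>\<omega>. X (int t) \<omega> $ i * X (int t) \<omega> $ j)\<bar>
    \<le> (10 + 2 * (2 * (2 * (K * 8 powr (1 / \<gamma>2)) ^ 8) + (1 + 2 * (K * 8 powr (1 / \<gamma>2)) ^ 8)\<^sup>2))
        * sqrt (2 * exp (- c * real (t - s) powr \<gamma>1))"
    by (intro covariance_truncation[OF subalgebra_window[OF ts] subalgebra_window[OF ts]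
          dependence_bound_beta_mixing[OF ts mix, where t = "int s"]] borel_measurable_times
        measurable_vec_component[OF F] measurable_vec_component[OF G] m ij) simp_all
  then show ?thesis unfolding E covariance_bound_def Let_def .
qed

text \<open>Markov's inequality for the squared Frobenius norm, whose mean is a sum of p^2 entrywise
  mean square errors of order 1 / n. Measurability of the event is recorded because tail events of
  the estimator are later enclosed in it.\<close>

lemma sample_cov_deviation:
  assumes ts: "time_series M p X" and st: "strictly_stationary M p X"
    and mix: "\<And>l. beta_mixing_coeff M p X l \<le> 2 * exp (- c * real l powr \<gamma>1)" and c: "c > 0" "\<gamma>1 > 0"
    and \<gamma>2: "\<gamma>2 > 0"
    and sw: "\<And>t. sub_weibull_vec M p \<gamma>2 (X t)" and psi: "\<And>t. psi_norm_vec M p \<gamma>2 (X t) \<le> ereal K"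
    and n: "n > 0" and B: "B > 0"
  shows "{\<omega> \<in> space M. B / sqrt (real n) \<le> frobenius_norm (sample_cov n p X \<omega> - pop_cov M p X)} \<in> sets M"
    and "measure M {\<omega> \<in> space M. B / sqrt (real n) \<le> frobenius_norm (sample_cov n p X \<omega> - pop_cov M p X)}
      \<le> (real p)\<^sup>2 * (2 * suminf (covariance_bound c \<gamma>1 \<gamma>2 K)) / B\<^sup>2"
proof -
  interpret prob_space M using ts by (simp add: time_series_def)
  have Xt: "X t \<in> measurable M (vec_borel p)" for t using ts by (simp add: time_series_def)
  define V where "V = 2 * suminf (covariance_bound c \<gamma>1 \<gamma>2 K)"
  define W where "W = (\<lambda>i j \<omega>. ((1 / real n) * (\<Sum>t=1..n. X (int t) \<omega> $ i * X (int t) \<omega> $ j) - pop_cov M p X $$ (i, j))\<^sup>2)"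
  have W: "integrable M (W i j) \<and> expectation (W i j) \<le> V / real n" if ij: "i < p" "j < p" for i j
  proof -
    note m = product_fourth_moment_bound[OF ts ij \<gamma>2 sw psi]
    have meas: "(\<lambda>\<omega>. X t \<omega> $ i * X t \<omega> $ j) \<in> borel_measurable M" for t
      by (intro borel_measurable_times measurable_vec_component[OF Xt] ij)
    have ZZ: "integrable M (\<lambda>\<omega>. (X s \<omega> $ i * X s \<omega> $ j) * (X t \<omega> $ i * X t \<omega> $ j))" for s t
    proof (rule Bochner_Integration.integrable_bound)
      show "integrable M (\<lambda>\<omega>. 1 + (X s \<omega> $ i * X s \<omega> $ j) ^ 4 + (X t \<omega> $ i * X t \<omega> $ j) ^ 4)"
        by (intro Bochner_Integration.integrable_add integrable_const m)
      show "AE \<omega> in M. norm ((X s \<omega> $ i * X s \<omega> $ j) * (X t \<omega> $ i * X t \<omega> $ j))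
          \<le> norm (1 + (X s \<omega> $ i * X s \<omega> $ j) ^ 4 + (X t \<omega> $ i * X t \<omega> $ j) ^ 4)"
        unfolding real_norm_def by (intro AE_I2 order_trans[OF abs_mult_le_power4 abs_ge_self])
    qed (intro borel_measurable_times[OF meas meas])
    have Z: "integrable M (\<lambda>\<omega>. X t \<omega> $ i * X t \<omega> $ j)" for t
    proof (rule Bochner_Integration.integrable_bound)
      show "integrable M (\<lambda>\<omega>. 1 + (X t \<omega> $ i * X t \<omega> $ j) ^ 4)"
        by (intro Bochner_Integration.integrable_add integrable_const m)
      show "AE \<omega> in M. norm (X t \<omega> $ i * X t \<omega> $ j) \<le> norm (1 + (X t \<omega> $ i * X t \<omega> $ j) ^ 4)"
        unfolding real_norm_def by (intro AE_I2 order_trans[OF abs_le_one_plus_power4 abs_ge_self])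
    qed (rule meas)
    have E: "expectation (\<lambda>\<omega>. X r \<omega> $ i * X r \<omega> $ j) = pop_cov M p X $$ (i, j)" for r
      using stationary_product_expectation[OF ts st ij, of r] ij by (simp add: pop_cov_def)
    note mse = mean_square_error_le[where Z = "\<lambda>t \<omega>. X (int t) \<omega> $ i * X (int t) \<omega> $ j",
        OF n Z E ZZ product_covariance_le[OF ts st mix c \<gamma>2 sw psi ij]
        summable_covariance_bound[OF c] covariance_bound_nonneg]
    show ?thesis using mse unfolding W_def V_def by simp
  qed
  define D where "D = (\<lambda>\<omega>. \<Sum>i<p. \<Sum>j<p. W i j \<omega>)"
  have frob: "frobenius_norm (sample_cov n p X \<omega> - pop_cov M p X) = sqrt (D \<omega>)" for \<omega>
    unfolding frobenius_norm_def D_def W_def by (simp add: sample_cov_def pop_cov_def)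
  have D0: "0 \<le> D \<omega>" for \<omega> unfolding D_def W_def by (intro sum_nonneg) simp
  have intD: "integrable M D" unfolding D_def using W by (intro Bochner_Integration.integrable_sum) auto
  have "expectation D = (\<Sum>i<p. \<Sum>j<p. expectation (W i j))"
  proof -
    have "expectation D = (\<Sum>i<p. expectation (\<lambda>\<omega>. \<Sum>j<p. W i j \<omega>))"
      unfolding D_def using W by (intro Bochner_Integration.integral_sum Bochner_Integration.integrable_sum) auto
    also have "\<dots> = (\<Sum>i<p. \<Sum>j<p. expectation (W i j))"
      using W by (intro sum.cong refl Bochner_Integration.integral_sum) auto
    finally show ?thesis .
  qed
  also have "\<dots> \<le> (\<Sum>i<p. \<Sum>j<p. V / real n)" using W by (intro sum_mono) auto
  also have "\<dots> = (real p)\<^sup>2 * (V / real n)" by (simp add: power2_eq_square)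
  finally have ED: "expectation D \<le> (real p)\<^sup>2 * (V / real n)" .
  have set_eq: "{\<omega> \<in> space M. B / sqrt (real n) \<le> frobenius_norm (sample_cov n p X \<omega> - pop_cov M p X)}
      = {\<omega> \<in> space M. B\<^sup>2 / real n \<le> D \<omega>}"
  proof -
    have "B / sqrt (real n) \<le> sqrt (D \<omega>) \<longleftrightarrow> B\<^sup>2 / real n \<le> D \<omega>" for \<omega>
    proof -
      have "B / sqrt (real n) = sqrt (B\<^sup>2 / real n)" using B by (simp add: real_sqrt_divide)
      then show ?thesis by simp
    qed
    then show ?thesis by (simp add: frob)
  qed
  have mD: "D \<in> borel_measurable M" using intD by (rule borel_measurable_integrable)
  show "{\<omega> \<in> space M. B / sqrt (real n) \<le> frobenius_norm (sample_cov n p X \<omega> - pop_cov M p X)} \<in> sets M"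
    unfolding set_eq using mD by measurable
  have "measure M {\<omega> \<in> space M. B\<^sup>2 / real n \<le> D \<omega>} \<le> expectation D / (B\<^sup>2 / real n)"
    by (rule integral_Markov_inequality_measure[OF intD sets.empty_sets]) (use D0 B n in auto)
  also have "\<dots> \<le> (real p)\<^sup>2 * (V / real n) / (B\<^sup>2 / real n)"
    using ED by (rule divide_right_mono) simp
  also have "\<dots> = (real p)\<^sup>2 * V / B\<^sup>2" using n by simp
  finally show "measure M {\<omega> \<in> space M. B / sqrt (real n) \<le> frobenius_norm (sample_cov n p X \<omega> - pop_cov M p X)}
      \<le> (real p)\<^sup>2 * (2 * suminf (covariance_bound c \<gamma>1 \<gamma>2 K)) / B\<^sup>2"
    unfolding set_eq V_def .
qed

section \<open>The two dimension regimes\<close>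

text \<open>Origin of the exponent 3/2: the tuning parameter contributes sqrt s0, the oracle bound
  another s0.\<close>

lemma sqrt_mult_self_powr: "sqrt (real s) * real s = real s powr (3 / 2)"
proof (cases "s = 0")
  case False
  then have "real s powr (3 / 2) = real s powr (1 / 2) * real s powr 1"
    by (subst powr_add[symmetric]) simp
  then show ?thesis by (simp add: powr_half_sqrt)
qed simp

lemma measurable_l1_error:
  assumes "Y \<in> measurable M (vec_borel p)" "v \<in> carrier_vec p"
  shows "(\<lambda>\<omega>. l1_norm (Y \<omega> - v)) \<in> borel_measurable M"
proof -
  have "(\<lambda>\<omega>. l1_norm (Y \<omega> - v)) = (\<lambda>\<omega>. \<Sum>j<p. \<bar>Y \<omega> $ j - v $ j\<bar>)"
    using assms(2) by (auto simp: l1_norm_def)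
  also have "\<dots> \<in> borel_measurable M"
    by (intro borel_measurable_sum borel_measurable_abs borel_measurable_diff borel_measurable_const
        measurable_vec_component[OF assms(1)]) auto
  finally show ?thesis .
qed

lemma pop_cov_carrier: "pop_cov M p X \<in> carrier_mat p p"
  by (simp add: pop_cov_def)

lemma sample_cov_carrier: "sample_cov n p X \<omega> \<in> carrier_mat p p"
  by (simp add: sample_cov_def)

lemma pop_cov_symmetric: "i < p \<Longrightarrow> j < p \<Longrightarrow> pop_cov M p X $$ (i, j) = pop_cov M p X $$ (j, i)"
  by (simp add: pop_cov_def mult.commute)

lemma sample_cov_symmetric:
  "i < p \<Longrightarrow> j < p \<Longrightarrow> sample_cov n p X \<omega> $$ (i, j) = sample_cov n p X \<omega> $$ (j, i)"
  by (simp add: sample_cov_def mult.commute)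

text \<open>Gives s0 >= 1, so that powers of s0 in the rate can only enlarge it.\<close>

lemma sparsity_pos:
  assumes "q \<in> carrier_vec p" "l2_norm q = 1" "k \<noteq> 0"
  shows "sparsity (k \<cdot>\<^sub>v q) \<ge> 1"
proof -
  have "\<exists>j<p. q $ j \<noteq> 0"
    using assms(1,2) by (auto simp: l2_norm_def intro: ccontr)
  then have "{j. j < dim_vec (k \<cdot>\<^sub>v q) \<and> (k \<cdot>\<^sub>v q) $ j \<noteq> 0} \<noteq> {}"
    using assms(1,3) by auto
  then show ?thesis unfolding sparsity_def by (simp add: Suc_le_eq card_gt_0_iff)
qed

lemma lasso_estimator_error_bound:
  assumes sp: "ordered_root_eigenvalues (pop_cov M p X) \<phi>" "eigenvector (pop_cov M p X) q ((\<phi> 1)\<^sup>2)"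
      "l2_norm q = 1" "\<beta>0 = \<phi> 1 \<cdot>\<^sub>v q" "\<And>j. j \<in> {2..p} \<Longrightarrow> \<phi> 1 \<ge> \<phi> j + \<sigma>"
    and const: "3 * \<eta> < \<sigma>" "0 < \<eta>" "p \<ge> 2" "lam \<ge> 0"
    and est: "lasso_estimator M n p X \<beta>0 \<eta> lam bhat" and \<omega>: "\<omega> \<in> space M"
  shows "2 * \<eta>\<^sup>2 * l1_norm (bhat \<omega> - \<beta>0)
    \<le> sqrt (real p) * (3 / 2 * \<phi> 1 * frobenius_norm (sample_cov n p X \<omega> - pop_cov M p X) + lam * sqrt (real p))"
proof -
  let ?obj = "lasso_objective (sample_cov n p X \<omega>) lam"
  have c0: "\<beta>0 \<in> carrier_vec p" using sp(2,4) by (simp add: eigenvector_def pop_cov_def)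
  have arg: "is_arg_min ?obj (\<lambda>\<beta>. \<beta> \<in> carrier_vec p \<and> l2_norm (\<beta> - \<beta>0) \<le> \<eta>) (bhat \<omega>)"
    using est \<omega> unfolding lasso_estimator_def by blast
  \<comment> \<open>\<beta>0 is the centre of the ball and hence an admissible competitor.\<close>
  have "l2_norm (\<beta>0 - \<beta>0) = 0" using c0 by (simp add: l2_norm_def)
  then have min: "?obj (bhat \<omega>) \<le> ?obj \<beta>0"
    using arg c0 const(2) unfolding is_arg_min_def by (auto simp: not_less)
  have b: "bhat \<omega> \<in> carrier_vec p" "l2_norm (bhat \<omega> - \<beta>0) \<le> \<eta>"
    using arg unfolding is_arg_min_def by auto
  have "2 * \<eta>\<^sup>2 * l1_norm (bhat \<omega> - \<beta>0) \<le> 2 * \<eta>\<^sup>2 * (sqrt (real p) * l2_norm (bhat \<omega> - \<beta>0))"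
    using l1_norm_le_l2_norm[of "bhat \<omega> - \<beta>0"] c0 by (intro mult_left_mono) auto
  also have "\<dots> = sqrt (real p) * (2 * \<eta>\<^sup>2 * l2_norm (bhat \<omega> - \<beta>0))" by simp
  also have "\<dots> \<le> sqrt (real p) * (3 / 2 * \<phi> 1 * frobenius_norm (sample_cov n p X \<omega> - pop_cov M p X) + lam * sqrt (real p))"
    by (intro mult_left_mono lasso_error_bound[OF pop_cov_carrier sample_cov_carrier
          pop_cov_symmetric sample_cov_symmetric sp const b min]) auto
  finally show ?thesis .
qed

text \<open>On the event that the sampling error is below B / sqrt n,
  \<open>lasso_estimator_error_bound\<close> is deterministic, and p <= P turns its powers of p into
  constants. The probability bound does not involve n, so it becomes small through the choice of B
  alone.\<close>

lemma low_dimension_tail: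
  assumes ts: "time_series M p X" and st: "strictly_stationary M p X"
    and mix: "\<And>l. beta_mixing_coeff M p X l \<le> 2 * exp (- c * real l powr \<gamma>1)" "c > 0" "\<gamma>1 > 0"
    and tail: "\<gamma>2 > 0" "\<And>t. sub_weibull_vec M p \<gamma>2 (X t)" "\<And>t. psi_norm_vec M p \<gamma>2 (X t) \<le> ereal K"
    and sp: "ordered_root_eigenvalues (pop_cov M p X) \<phi>" "eigenvector (pop_cov M p X) q ((\<phi> 1)\<^sup>2)"
      "l2_norm q = 1" "\<beta>0 = \<phi> 1 \<cdot>\<^sub>v q" "\<And>j. j \<in> {2..p} \<Longrightarrow> \<phi> 1 \<ge> \<phi> j + \<sigma>"
    and const: "3 * \<eta> < \<sigma>" "0 < \<eta>" "p \<ge> 2" "lam \<ge> 0"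
    and est: "lasso_estimator M n p X \<beta>0 \<eta> lam bhat"
    and n: "n > 0" and B: "B > 0" and P: "p \<le> P"
    and lam: "lam \<le> D * (sqrt (real (sparsity \<beta>0)) * \<phi> 1 * sqrt (ln (real p) / real n))" and D: "D > 0"
    and \<phi>: "\<phi> 1 > 0"
  defines "r \<equiv> real (sparsity \<beta>0) powr (3 / 2) * \<phi> 1 * sqrt (ln (real p) / real n)"
    and "B' \<equiv> sqrt (real P) * (3 / 2 * B / sqrt (ln 2) + D * sqrt (real P)) / (2 * \<eta>\<^sup>2)"
  shows "measure M {\<omega> \<in> space M. l1_norm (bhat \<omega> - \<beta>0) > B' * r}
    \<le> (real P)\<^sup>2 * (2 * suminf (covariance_bound c \<gamma>1 \<gamma>2 K)) / B\<^sup>2"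
proof -
  interpret prob_space M using ts by (simp add: time_series_def)
  let ?F = "\<lambda>\<omega>. frobenius_norm (sample_cov n p X \<omega> - pop_cov M p X)"
  let ?L = "sqrt (ln (real p) / real n)"
  note dev = sample_cov_deviation[OF ts st mix tail n B]
  have s1: "1 \<le> real (sparsity \<beta>0)"
    using sparsity_pos[of q p "\<phi> 1"] sp \<phi> by (simp add: eigenvector_def pop_cov_def)
  have s32: "1 \<le> real (sparsity \<beta>0) powr (3 / 2)" "sqrt (real (sparsity \<beta>0)) \<le> real (sparsity \<beta>0) powr (3 / 2)"
    using s1 by (auto simp: ge_one_powr_ge_zero powr_half_sqrt[symmetric] intro!: powr_mono)
  have L0: "0 \<le> ?L" using const by simp
  have sub: "l1_norm (bhat \<omega> - \<beta>0) \<le> B' * r" if \<omega>: "\<omega> \<in> space M" and F: "?F \<omega> < B / sqrt (real n)" for \<omega>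
  proof -
    \<comment> \<open>The lower bound ln p >= ln 2 is what allows the parametric rate 1 / sqrt n to
      be absorbed; it explains the ln 2 in B'.\<close>
    have "1 / sqrt (real n) \<le> ?L / sqrt (ln 2)"
    proof -
      have "sqrt (ln 2) \<le> sqrt (ln (real p))" using const by simp
      then show ?thesis using n by (simp add: real_sqrt_divide field_simps)
    qed
    then have "\<phi> 1 * (1 / sqrt (real n)) \<le> \<phi> 1 * (?L / sqrt (ln 2))"
      using \<phi> by (intro mult_left_mono) auto
    also have "\<dots> \<le> real (sparsity \<beta>0) powr (3 / 2) * (\<phi> 1 * (?L / sqrt (ln 2)))"
      using mult_right_mono[OF s32(1), of "\<phi> 1 * (?L / sqrt (ln 2))"] \<phi> L0 by simp
    finally have 1: "\<phi> 1 * (1 / sqrt (real n)) \<le> r / sqrt (ln 2)" by (simp add: r_def)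
    have "3 / 2 * \<phi> 1 * ?F \<omega> \<le> 3 / 2 * \<phi> 1 * (B / sqrt (real n))"
      using F \<phi> by (intro mult_left_mono) auto
    also have "\<dots> = 3 / 2 * B * (\<phi> 1 * (1 / sqrt (real n)))" by simp
    also have "\<dots> \<le> 3 / 2 * B * (r / sqrt (ln 2))" using 1 B by (intro mult_left_mono) auto
    finally have 2: "3 / 2 * \<phi> 1 * ?F \<omega> \<le> 3 / 2 * B / sqrt (ln 2) * r" by simp
    \<comment> \<open>The penalty carries only sqrt s0, which s0 >= 1 lets grow to s0^(3/2).\<close>
    have "sqrt (real (sparsity \<beta>0)) * \<phi> 1 * ?L \<le> r"
      unfolding r_def using s32(2) \<phi> L0 by (intro mult_right_mono) auto
    then have "lam \<le> D * r" using lam D by (smt (verit) mult_left_mono)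
    moreover have r0: "0 \<le> r" unfolding r_def using \<phi> L0 by simp
    ultimately have 3: "lam * sqrt (real p) \<le> D * r * sqrt (real P)"
      using P D const by (intro mult_mono) auto
    have "2 * \<eta>\<^sup>2 * l1_norm (bhat \<omega> - \<beta>0) \<le> sqrt (real p) * (3 / 2 * \<phi> 1 * ?F \<omega> + lam * sqrt (real p))"
      by (rule lasso_estimator_error_bound[OF sp const est \<omega>])
    also have "\<dots> \<le> sqrt (real P) * (3 / 2 * B / sqrt (ln 2) * r + D * r * sqrt (real P))"
    proof (rule mult_mono)
      show "0 \<le> 3 / 2 * \<phi> 1 * ?F \<omega> + lam * sqrt (real p)"
        using \<phi> const(4) by (intro add_nonneg_nonneg mult_nonneg_nonneg) (auto simp: frobenius_norm_def sum_nonneg)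
    qed (use 2 3 P in auto)
    also have "\<dots> = 2 * \<eta>\<^sup>2 * (B' * r)" using const by (simp add: B'_def field_simps)
    finally show ?thesis using const by simp
  qed
  have "prob {\<omega> \<in> space M. l1_norm (bhat \<omega> - \<beta>0) > B' * r} \<le> prob {\<omega> \<in> space M. B / sqrt (real n) \<le> ?F \<omega>}"
  proof (rule finite_measure_mono[OF _ dev(1)], rule subsetI)
    fix \<omega> assume *: "\<omega> \<in> {\<omega> \<in> space M. l1_norm (bhat \<omega> - \<beta>0) > B' * r}"
    then have "\<not> ?F \<omega> < B / sqrt (real n)" using sub[of \<omega>] by auto
    then show "\<omega> \<in> {\<omega> \<in> space M. B / sqrt (real n) \<le> ?F \<omega>}" using * by auto
  qed
  also note dev(2)
  also have "(real p)\<^sup>2 * (2 * suminf (covariance_bound c \<gamma>1 \<gamma>2 K)) / B\<^sup>2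
      \<le> (real P)\<^sup>2 * (2 * suminf (covariance_bound c \<gamma>1 \<gamma>2 K)) / B\<^sup>2"
    using P by (intro divide_right_mono mult_right_mono power_mono)
      (auto intro!: suminf_nonneg summable_covariance_bound mix covariance_bound_nonneg)
  finally show ?thesis .
qed

text \<open>Choosing \<xi> as half of \<sigma> - 3 \<eta> makes the denominator \<sigma> - 3 \<eta>
  - \<xi> equal to \<xi> again, a constant that goes into B. The tail event is the complement of an
  event containing the one in the oracle inequality.\<close>

lemma oracle_tail:
  assumes M: "prob_space M"
    and oi: "oracle_inequality M n p X \<beta>0 \<sigma> \<eta> K2 \<gamma> C C1 C2"
    and prem: "b > 0" "\<zeta> > tau2 K2 C1 C2 \<gamma> b n p" "tau1 K2 C1 \<gamma> n < \<xi>"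
      "lam > (C + 1) / (C - 1) * \<zeta> * l1_norm \<beta>0"
    and \<xi>: "\<xi> > 0" "\<sigma> - 3 * \<eta> = 2 * \<xi>"
    and est: "lasso_estimator M n p X \<beta>0 \<eta> lam bhat" and c0: "\<beta>0 \<in> carrier_vec p"
    and lam: "lam \<le> D * (sqrt (real (sparsity \<beta>0)) * \<phi> * sqrt (ln (real p) / real n))"
  defines "r \<equiv> real (sparsity \<beta>0) powr (3 / 2) * \<phi> * sqrt (ln (real p) / real n)"
    and "B \<equiv> 2 * (C + 1)\<^sup>2 * D / \<xi>"
  shows "measure M {\<omega> \<in> space M. l1_norm (bhat \<omega> - \<beta>0) > B * r}
    \<le> 2 * exp (- b * ln ((real p)\<^sup>2)) + 2 * real n * exp (- ((\<xi> * real n) powr \<gamma> / (K2 powr \<gamma> * C1)))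
      + 2 * exp (- (\<xi>\<^sup>2 * real n / (K2\<^sup>2 * C2)))"
proof -
  interpret prob_space M by (rule M)
  let ?Z = "\<lambda>\<omega>. l1_norm (bhat \<omega> - \<beta>0)" and ?u = "2 * (C + 1)\<^sup>2 * real (sparsity \<beta>0) * lam / \<xi>"
  have Z[measurable]: "?Z \<in> borel_measurable M"
    using est c0 by (intro measurable_l1_error) (auto simp: lasso_estimator_def)
  have "\<xi> < \<sigma> - 3 * \<eta>" "\<sigma> - 3 * \<eta> - \<xi> = \<xi>" using \<xi> by auto
  then have "prob {\<omega> \<in> space M. ?Z \<omega> \<le> ?u} \<ge> 1 - 2 * exp (- b * ln ((real p)\<^sup>2))
      - 2 * real n * exp (- ((\<xi> * real n) powr \<gamma> / (K2 powr \<gamma> * C1))) - 2 * exp (- (\<xi>\<^sup>2 * real n / (K2\<^sup>2 * C2)))"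
    using oi[unfolded oracle_inequality_def, rule_format, of b \<zeta> \<xi> lam bhat] prem est by simp
  moreover have "?u \<le> B * r"
  proof -
    have "?u = 2 * (C + 1)\<^sup>2 * real (sparsity \<beta>0) / \<xi> * lam" by simp
    also have "\<dots> \<le> 2 * (C + 1)\<^sup>2 * real (sparsity \<beta>0) / \<xi> *
        (D * (sqrt (real (sparsity \<beta>0)) * \<phi> * sqrt (ln (real p) / real n)))"
      using \<xi> lam by (intro mult_left_mono) auto
    also have "\<dots> = B * ((sqrt (real (sparsity \<beta>0)) * real (sparsity \<beta>0)) * \<phi> * sqrt (ln (real p) / real n))"
      by (simp add: B_def)
    also have "\<dots> = B * r" unfolding sqrt_mult_self_powr r_def ..
    finally show ?thesis .
  qed
  then have "prob {\<omega> \<in> space M. ?Z \<omega> \<le> ?u} \<le> prob {\<omega> \<in> space M. ?Z \<omega> \<le> B * r}"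
    by (intro finite_measure_mono) (auto intro: order_trans)
  moreover have "prob {\<omega> \<in> space M. \<not> ?Z \<omega> \<le> B * r} = 1 - prob {\<omega> \<in> space M. ?Z \<omega> \<le> B * r}"
    by (rule prob_neg) measurable
  ultimately show ?thesis by (simp add: not_le)
qed

lemma (in prob_space) prob_greater_mono:
  assumes [measurable]: "Z \<in> borel_measurable M" and "u \<le> (v :: real)"
  shows "prob {\<omega> \<in> space M. Z \<omega> > v} \<le> prob {\<omega> \<in> space M. Z \<omega> > u}"
  using assms(2) by (intro finite_measure_mono) auto

text \<open>The constant is squared along with the rate. Applied with Y the squared l2 error and Z
  the l1 error, which dominates the l2 error.\<close>

lemma bounded_in_prob_square:
  assumes Z: "bounded_in_prob M Z r"
    and M: "\<forall>\<^sub>F n in sequentially. prob_space (M n) \<and> Z n \<in> borel_measurable (M n) \<and> 0 \<le> r n \<and> r' n = (r n)\<^sup>2"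
    and le: "\<And>n \<omega>. \<bar>Y n \<omega>\<bar> \<le> (Z n \<omega>)\<^sup>2"
  shows "bounded_in_prob M Y r'"
  unfolding bounded_in_prob_def
proof (intro allI impI)
  fix \<epsilon> :: real assume "\<epsilon> > 0"
  then obtain B where B: "B > 0" "\<forall>\<^sub>F n in sequentially. measure (M n) {\<omega> \<in> space (M n). \<bar>Z n \<omega>\<bar> > B * r n} < \<epsilon>"
    using Z unfolding bounded_in_prob_def by blast
  have "\<forall>\<^sub>F n in sequentially. measure (M n) {\<omega> \<in> space (M n). \<bar>Y n \<omega>\<bar> > B\<^sup>2 * r' n} < \<epsilon>"
    using B(2) M
  proof eventually_elim
    case (elim n)
    interpret prob_space "M n" using elim by simp
    have [measurable]: "Z n \<in> borel_measurable (M n)" using elim by simp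
    have "prob {\<omega> \<in> space (M n). \<bar>Y n \<omega>\<bar> > B\<^sup>2 * r' n} \<le> prob {\<omega> \<in> space (M n). \<bar>Z n \<omega>\<bar> > B * r n}"
    proof (rule finite_measure_mono)
      show "{\<omega> \<in> space (M n). \<bar>Y n \<omega>\<bar> > B\<^sup>2 * r' n} \<subseteq> {\<omega> \<in> space (M n). \<bar>Z n \<omega>\<bar> > B * r n}"
      proof safe
        fix \<omega> assume "B\<^sup>2 * r' n < \<bar>Y n \<omega>\<bar>"
        then have "(B * r n)\<^sup>2 < \<bar>Z n \<omega>\<bar>\<^sup>2"
          using le[of n \<omega>] elim by (simp add: power_mult_distrib)
        then show "B * r n < \<bar>Z n \<omega>\<bar>" by (rule power2_less_imp_less) simp
      qed
    qed measurable
    then show ?case using elim by simp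
  qed
  then show "\<exists>B>0. \<forall>\<^sub>F n in sequentially. measure (M n) {\<omega> \<in> space (M n). \<bar>Y n \<omega>\<bar> > B * r' n} < \<epsilon>"
    using B(1) by (intro exI[of _ "B\<^sup>2"]) simp
qed

section \<open>Combination of the two regimes\<close>

theorem corollary4p3:
  fixes M :: "nat \<Rightarrow> 'a measure"
    and p :: "nat \<Rightarrow> nat"
    and X :: "nat \<Rightarrow> int \<Rightarrow> 'a \<Rightarrow> real vec"
    and \<phi> :: "nat \<Rightarrow> nat \<Rightarrow> real"
    and q0 \<beta>0 :: "nat \<Rightarrow> real vec"
    and bhat :: "nat \<Rightarrow> 'a \<Rightarrow> real vec"
    and \<zeta> \<xi> lam1 :: "nat \<Rightarrow> real"
    and \<sigma> \<eta> c \<gamma>1 \<gamma>2 \<gamma> K K2 C b C1 C2 :: real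
  assumes process: "\<And>n. n > 4 \<Longrightarrow> time_series (M n) (p n) (X n)"
      "\<And>n. n > 4 \<Longrightarrow> strictly_stationary (M n) (p n) (X n)"
      "\<And>n. n > 4 \<Longrightarrow> centered (M n) (p n) (X n)"
    and eigenvalues:
      "\<And>n. n > 4 \<Longrightarrow> ordered_root_eigenvalues (pop_cov (M n) (p n) (X n)) (\<phi> n)"
    and leading:
      "\<And>n. n > 4 \<Longrightarrow> eigenvector (pop_cov (M n) (p n) (X n)) (q0 n) ((\<phi> n 1)\<^sup>2)"
      "\<And>n. n > 4 \<Longrightarrow> l2_norm (q0 n) = 1"
      "\<And>n. n > 4 \<Longrightarrow> \<beta>0 n = \<phi> n 1 \<cdot>\<^sub>v q0 n"
    and dimension: "(\<lambda>n. ln (real (p n)) / real n) \<in> o(\<lambda>_. 1)"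
    and gap: "\<sigma> > 3 * \<eta>" "3 * \<eta> > 0"
      "\<And>n j. n > 4 \<Longrightarrow> j \<in> {2..p n} \<Longrightarrow> \<phi> n 1 \<ge> \<phi> n j + \<sigma>"
    and mixing: "c > 0" "\<gamma>1 > 0"
      "\<And>n l. n > 4 \<Longrightarrow>
         beta_mixing_coeff (M n) (p n) (X n) l \<le> 2 * exp (- c * real l powr \<gamma>1)"
    and tails: "\<gamma>2 > 0" "K > 0"
      "\<And>n t. n > 4 \<Longrightarrow> sub_weibull_vec (M n) (p n) \<gamma>2 (X n t)"
      "\<And>n t. n > 4 \<Longrightarrow> psi_norm_vec (M n) (p n) \<gamma>2 (X n t) \<le> ereal K"
    and gamma: "\<gamma> = inverse (1 / \<gamma>1 + 2 / \<gamma>2)" "\<gamma> < 1"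
    and dimension_gamma: "(\<lambda>n. ln (real (p n)) / real n powr \<gamma>) \<in> o(\<lambda>_. 1)"
    and constants: "C > 1" "b > 0" "C1 > 0" "C2 > 0" "K2 = K2_const \<gamma>2 K"
    and oracle_ineq:
      "\<And>n. n > 4 \<Longrightarrow>
         oracle_inequality (M n) n (p n) (X n) (\<beta>0 n) \<sigma> \<eta> K2 \<gamma> C C1 C2"
    and estimator:
      "\<And>n. n > 4 \<Longrightarrow> lasso_estimator (M n) n (p n) (X n) (\<beta>0 n) \<eta> (lam1 n) (bhat n)"
    and tuning:
      "\<And>n. n > 4 \<Longrightarrow> \<zeta> n > tau2 K2 C1 C2 \<gamma> b n (p n)"
      "\<And>n. n > 4 \<Longrightarrow> tau1 K2 C1 \<gamma> n < \<xi> n"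
      "\<And>n. n > 4 \<Longrightarrow> \<xi> n < \<sigma> - 3 * \<eta>"
      "\<And>n. n > 4 \<Longrightarrow> lam1 n > (C + 1) / (C - 1) * \<zeta> n * l1_norm (\<beta>0 n)"
    and xi_rate:
      "\<exists>\<alpha>\<in>{0<..<1 / 2}.
         \<xi> \<in> \<Theta>(\<lambda>n. ln (real n) powr (1 / \<gamma>) / real n powr (1 - \<alpha>))"
    and lam1_rate:
      "lam1 \<in> \<Theta>(\<lambda>n. sqrt (real (sparsity (\<beta>0 n))) * \<phi> n 1 * sqrt (ln (real (p n)) / real n))"
  shows "bounded_in_prob M (\<lambda>n \<omega>. l1_norm (bhat n \<omega> - \<beta>0 n))
           (\<lambda>n. real (sparsity (\<beta>0 n)) powr (3 / 2) * \<phi> n 1 * sqrt (ln (real (p n)) / real n)) \<and>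
         bounded_in_prob M (\<lambda>n \<omega>. (l2_norm (bhat n \<omega> - \<beta>0 n))\<^sup>2)
           (\<lambda>n. real (sparsity (\<beta>0 n)) ^ 3 * (\<phi> n 1)\<^sup>2 * (ln (real (p n)) / real n))"
proof -
  define L where "L = (\<lambda>n. sqrt (ln (real (p n)) / real n))"
  define rate where "rate = (\<lambda>n. real (sparsity (\<beta>0 n)) powr (3 / 2) * \<phi> n 1 * L n)"
  define Z where "Z = (\<lambda>n \<omega>. l1_norm (bhat n \<omega> - \<beta>0 n))"
  define \<xi>' where "\<xi>' = (\<sigma> - 3 * \<eta>) / 2"
  have \<xi>': "\<xi>' > 0" "\<sigma> - 3 * \<eta> = 2 * \<xi>'" using gap by (auto simp: \<xi>'_def)
  have K2: "K2 > 0" using constants(5) tails by (simp add: K2_const_def)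
  have \<gamma>0: "\<gamma> > 0" unfolding gamma(1) using mixing tails by (simp add: add_pos_pos)
  have \<eta>: "0 < \<eta>" using gap(2) by simp
  have M: "prob_space (M n)" if "n > 4" for n using process(1)[OF that] by (simp add: time_series_def)
  have q: "q0 n \<in> carrier_vec (p n)" if "n > 4" for n
    using leading(1)[OF that] by (simp add: eigenvector_def pop_cov_def)
  have c0: "\<beta>0 n \<in> carrier_vec (p n)" if "n > 4" for n using q[OF that] leading(3)[OF that] by simp
  have p1: "p n \<ge> 1" if n: "n > 4" for n
  proof (rule ccontr)
    assume "\<not> p n \<ge> 1"
    then have "p n = 0" by simp
    then have "l2_norm (q0 n) = 0" using q[OF n] by (simp add: l2_norm_def)
    then show False using leading(2)[OF n] by simp
  qed
  have \<phi>_nonneg: "0 \<le> \<phi> n j" if "n > 4" "j \<in> {1..p n}" for n j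
    using eigenvalues[OF that(1)] that(2) by (auto simp: ordered_root_eigenvalues_def pop_cov_def)
  have L0: "0 \<le> L n" if "n > 4" for n using p1[OF that] by (simp add: L_def)
  have rate0: "0 \<le> rate n" if "n > 4" for n
    unfolding rate_def using \<phi>_nonneg[OF that, of 1] p1[OF that] L0[OF that] by simp
  have mZ: "Z n \<in> borel_measurable (M n)" if "n > 4" for n
    unfolding Z_def using estimator[OF that] c0[OF that]
    by (intro measurable_l1_error) (auto simp: lasso_estimator_def)
  \<comment> \<open>\<open>\<zeta> n\<close> exceeds a maximum one of whose entries is a nonnegative
    square root, so the strict lower bound imposed on \<open>lam1 n\<close> is itself
    nonnegative.\<close>
  have lam0: "lam1 n > 0" if n: "n > 4" for n
  proof -
    have "0 \<le> ln (real (p n))" using p1[OF n] by simp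
    then have "0 \<le> K2 * sqrt (2 * C2 * (b + 1) * ln (real (p n)) / real n)"
      using K2 constants by simp
    then have "0 \<le> tau2 K2 C1 C2 \<gamma> b n (p n)" unfolding tau2_def by (rule max.coboundedI2)
    then have "0 \<le> \<zeta> n" using tuning(1)[OF n] by linarith
    then have "0 \<le> (C + 1) / (C - 1) * \<zeta> n * l1_norm (\<beta>0 n)"
      using constants(1) by (intro mult_nonneg_nonneg l1_norm_nonneg) auto
    then show ?thesis using tuning(4)[OF n] by linarith
  qed
  obtain D where D: "D > 0" "\<forall>\<^sub>F n in sequentially. norm (lam1 n) \<le> D * norm (sqrt (real (sparsity (\<beta>0 n))) * \<phi> n 1 * L n)"
    using bigthetaD1[OF lam1_rate] unfolding L_def by (auto elim!: landau_o.bigE)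
  have lam: "\<forall>\<^sub>F n in sequentially. n > 4 \<and> p n \<ge> 2 \<and> lam1 n \<le> D * (sqrt (real (sparsity (\<beta>0 n))) * \<phi> n 1 * L n)"
    using D(2) eventually_gt_at_top[of 4]
  proof eventually_elim
    case (elim n)
    have "0 \<le> sqrt (real (sparsity (\<beta>0 n))) * \<phi> n 1 * L n"
      using \<phi>_nonneg[of n 1] p1[of n] L0[of n] elim by simp
    then have le: "lam1 n \<le> D * (sqrt (real (sparsity (\<beta>0 n))) * \<phi> n 1 * L n)" using elim by simp
    have "p n \<noteq> 1" using le lam0[of n] elim by (auto simp: L_def)
    then show ?case using le p1[of n] elim by simp
  qed
  define e1 where "e1 = (\<lambda>n. 2 * real n * exp (- ((\<xi>' * real n) powr \<gamma> / (K2 powr \<gamma> * C1))))"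
  define e2 where "e2 = (\<lambda>n. 2 * exp (- (\<xi>'\<^sup>2 * real n / (K2\<^sup>2 * C2))))"
  define k1 where "k1 = K2 powr \<gamma> * C1"
  define k2 where "k2 = \<xi>'\<^sup>2 / (K2\<^sup>2 * C2)"
  have k: "k1 > 0" "k2 > 0" using K2 constants \<xi>' by (simp_all add: k1_def k2_def)
  \<comment> \<open>At a fixed level the exponent is a multiple of n^\<gamma> with \<gamma> > 0,
    which outweighs the prefactor n.\<close>
  have e1: "e1 \<longlonglongrightarrow> 0" unfolding e1_def k1_def[symmetric] using k \<xi>'(1) \<gamma>0 by real_asymp
  have e2: "e2 \<longlonglongrightarrow> 0"
  proof -
    have "e2 = (\<lambda>n. 2 * exp (- (k2 * real n)))" by (simp add: e2_def k2_def)
    then show ?thesis using k by simp real_asymp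
  qed
  \<comment> \<open>Ensures that the fixed level \<open>\<xi>'\<close> eventually exceeds
    \<open>tau1\<close>, as the oracle inequality demands.\<close>
  have tau1_lim: "(\<lambda>n. tau1 K2 C1 \<gamma> n) \<longlonglongrightarrow> 0"
    unfolding tau1_def using \<gamma>0 by real_asymp
  have main: "bounded_in_prob M Z rate"
    unfolding bounded_in_prob_def
  proof (intro allI impI)
    fix \<epsilon> :: real assume \<epsilon>: "\<epsilon> > 0"
    have "(\<lambda>m :: nat. 2 * exp (- b * ln ((real m)\<^sup>2))) \<longlonglongrightarrow> 0"
      using constants(2) by real_asymp
    from order_tendstoD(2)[OF this, of "\<epsilon> / 3"] \<epsilon>
    have "\<forall>\<^sub>F m :: nat in sequentially. 2 * exp (- b * ln ((real m)\<^sup>2)) < \<epsilon> / 3" by simp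
    then obtain P where P: "\<And>m :: nat. m \<ge> P \<Longrightarrow> 2 * exp (- b * ln ((real m)\<^sup>2)) < \<epsilon> / 3"
      unfolding eventually_sequentially by blast
    define V where "V = (real P)\<^sup>2 * (2 * suminf (covariance_bound c \<gamma>1 \<gamma>2 K))"
    have "0 \<le> suminf (covariance_bound c \<gamma>1 \<gamma>2 K)"
      by (intro suminf_nonneg summable_covariance_bound mixing(1,2) covariance_bound_nonneg)
    then have V0: "0 \<le> V" by (simp add: V_def)
    \<comment> \<open>Chosen so that V / Bn^2 = \<epsilon> V / (V + \<epsilon>) < \<epsilon>; the
      summand 1 keeps \<open>Bn\<close> positive when V = 0.\<close>
    define Bn where "Bn = sqrt (V / \<epsilon> + 1)"
    have Bn: "Bn > 0" "V / Bn\<^sup>2 < \<epsilon>"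
      using V0 \<epsilon> by (simp_all add: Bn_def add_nonneg_pos field_simps)
    define B1 where "B1 = sqrt (real P) * (3 / 2 * Bn / sqrt (ln 2) + D * sqrt (real P)) / (2 * \<eta>\<^sup>2)"
    define B2 where "B2 = 2 * (C + 1)\<^sup>2 * D / \<xi>'"
    \<comment> \<open>The maximum covers both regimes at once, since different n may fall on
      different sides of P; the entry 1 makes B positive.\<close>
    define B where "B = max 1 (max B1 B2)"
    have B: "B1 \<le> B" "B2 \<le> B" by (simp_all add: B_def)
    have "\<forall>\<^sub>F n in sequentially. e1 n < \<epsilon> / 3" "\<forall>\<^sub>F n in sequentially. e2 n < \<epsilon> / 3"
      "\<forall>\<^sub>F n in sequentially. tau1 K2 C1 \<gamma> n < \<xi>'"
      using order_tendstoD(2)[OF e1, of "\<epsilon> / 3"] order_tendstoD(2)[OF e2, of "\<epsilon> / 3"]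
        order_tendstoD(2)[OF tau1_lim \<xi>'(1)] \<epsilon> by auto
    with lam have "\<forall>\<^sub>F n in sequentially. measure (M n) {\<omega> \<in> space (M n). \<bar>Z n \<omega>\<bar> > B * rate n} < \<epsilon>"
    proof eventually_elim
      case (elim n)
      then have n: "n > 4" and p2: "p n \<ge> 2" by auto
      have le: "lam1 n \<le> D * (sqrt (real (sparsity (\<beta>0 n))) * \<phi> n 1 * sqrt (ln (real (p n)) / real n))"
        using elim by (simp add: L_def)
      interpret prob_space "M n" by (rule M[OF n])
      \<comment> \<open>Tail probabilities decrease in the constant because the rate is nonnegative,
        so each regime may be treated with its own smaller constant.\<close>
      have shrink: "prob {\<omega> \<in> space (M n). \<bar>Z n \<omega>\<bar> > B * rate n} \<le> prob {\<omega> \<in> space (M n). Z n \<omega> > B' * rate n}"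
        if "B' \<le> B" for B'
      proof -
        have "\<bar>Z n \<omega>\<bar> = Z n \<omega>" for \<omega> by (simp add: Z_def l1_norm_nonneg)
        then show ?thesis
          using prob_greater_mono[OF mZ[OF n] mult_right_mono[OF that rate0[OF n]]] by simp
      qed
      show "prob {\<omega> \<in> space (M n). \<bar>Z n \<omega>\<bar> > B * rate n} < \<epsilon>"
      proof (cases "p n \<le> P")
        case True
        have "0 \<le> \<phi> n 2" using \<phi>_nonneg[OF n, of 2] p2 by simp
        then have \<phi>1: "\<phi> n 1 > 0" using gap(3)[OF n, of 2] p2 gap(1,2) by simp
        have "prob {\<omega> \<in> space (M n). Z n \<omega> > B1 * rate n} \<le> V / Bn\<^sup>2"
          unfolding Z_def B1_def rate_def V_def L_def
          by (rule low_dimension_tail[where q = "q0 n" and \<phi> = "\<phi> n" and \<sigma> = \<sigma>, OF process(1,2)[OF n] mixing(3)[OF n] mixing(1,2)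
                tails(1) tails(3,4)[OF n] eigenvalues[OF n] leading[OF n] gap(3)[OF n] gap(1) \<eta> p2
                less_imp_le[OF lam0[OF n]] estimator[OF n] _ Bn(1) True le D(1) \<phi>1]) (use n in auto)
        then show ?thesis using shrink[OF B(1)] Bn(2) by linarith
      next
        case False
        have "prob {\<omega> \<in> space (M n). Z n \<omega> > B2 * rate n}
            \<le> 2 * exp (- b * ln ((real (p n))\<^sup>2)) + e1 n + e2 n"
          unfolding Z_def B2_def rate_def L_def e1_def e2_def
          by (rule oracle_tail[OF M[OF n] oracle_ineq[OF n] constants(2) tuning(1)[OF n] _ tuning(4)[OF n]
                \<xi>' estimator[OF n] c0[OF n] le]) (use elim in auto)
        \<comment> \<open>One third each for the dimension term, through p > P, and for the two
          terms vanishing with n.\<close>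
        also have "\<dots> < \<epsilon> / 3 + \<epsilon> / 3 + \<epsilon> / 3" using P[of "p n"] False elim by auto
        finally show ?thesis using shrink[OF B(2)] by linarith
      qed
    qed
    moreover have "B > 0" by (simp add: B_def)
    ultimately show "\<exists>B>0. \<forall>\<^sub>F n in sequentially. measure (M n) {\<omega> \<in> space (M n). \<bar>Z n \<omega>\<bar> > B * rate n} < \<epsilon>"
      by blast
  qed
  moreover have "bounded_in_prob M (\<lambda>n \<omega>. (l2_norm (bhat n \<omega> - \<beta>0 n))\<^sup>2)
           (\<lambda>n. real (sparsity (\<beta>0 n)) ^ 3 * (\<phi> n 1)\<^sup>2 * (ln (real (p n)) / real n))"
  proof (rule bounded_in_prob_square[OF main])
    show "\<bar>(l2_norm (bhat n \<omega> - \<beta>0 n))\<^sup>2\<bar> \<le> (Z n \<omega>)\<^sup>2" for n \<omega>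
      by (simp add: Z_def l2_norm_le_l1_norm l2_norm_nonneg power_mono)
    show "\<forall>\<^sub>F n in sequentially. prob_space (M n) \<and> Z n \<in> borel_measurable (M n) \<and> 0 \<le> rate n
        \<and> real (sparsity (\<beta>0 n)) ^ 3 * (\<phi> n 1)\<^sup>2 * (ln (real (p n)) / real n) = (rate n)\<^sup>2"
      using eventually_gt_at_top[of 4]
    proof eventually_elim
      case (elim n)
      have "(L n)\<^sup>2 = ln (real (p n)) / real n" using p1[OF elim] by (simp add: L_def)
      moreover have "(real (sparsity (\<beta>0 n)) powr (3 / 2))\<^sup>2 = real (sparsity (\<beta>0 n)) ^ 3"
        by (simp add: sqrt_mult_self_powr[symmetric] power_mult_distrib power3_eq_cube power2_eq_square)
      ultimately show ?case using M[OF elim] mZ[OF elim] rate0[OF elim]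
        by (simp add: rate_def power_mult_distrib)
    qed
  qed
  ultimately show ?thesis by (simp add: Z_def[abs_def] rate_def[abs_def] L_def)
qed

end
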